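(* Let $n\ge1$ and let $B$ be a Blaschke product of degree $n$, $$B(z)=e^{i\theta}\prod_{j=1}^n\frac{z-a_j}{1-\overline{a_j}\,z},\qquad |a_j|<1,\ \theta\in\mathbb R,$$ and let $k=\sqrt[n]{B}:\mathbb T\to\mathbb T$, i.e. $k$ is a continuous map with $k(z)^n=B(z)$ for all $z\in\mathbb T$. Then there is a proper lemniscate $\Gamma\subset\mathbb C$ of degree $n$ whose fingerprint is $k$. Moreover, if $\tilde\Gamma\subset\mathbb C$ is any other $C^1$-smooth Jordan curve with the same fingerprint, then there is an affine linear transformation $T(z)=az+b$, with $a>0$ and $b\in\mathbb C$, such that $\tilde\Gamma=T(\Gamma)$.
   Context: $\mathbb D=\{|z|<1\}$, $\mathbb T=\partial\mathbb D$, $\hat{\mathbb C}=\mathbb C\cup\{\infty\}$ is the Riemann sphere, and $\mathbb D_+=\hat{\mathbb C}\setminus\overline{\mathbb D}$. Proper lemniscate: for a complex polynomial $P$ of degree $n$, the lemniscate $\Gamma=\{z\in\mathbb C:|P(z)|=1\}$ is called a proper lemniscate of degree $n$ if it is smooth, meaning $P'(z)\neq0$ for all $z\in\Gamma$, and $\{z\in\mathbb C:|P(z)|<1\}$ is connected. In that case $\Gamma$ is a smooth Jordan curve whose interior is $\{|P|<1\}$. Fingerprint: let $\Gamma\subset\mathbb C$ be a ($C^1$-)smooth Jordan curve, $\Omega_-$ the bounded component of $\mathbb C\setminus\Gamma$ and $\Omega_+=\hat{\mathbb C}\setminus\overline{\Omega_-}$. Let $\Phi_-:\mathbb D\to\Omega_-$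 be any Riemann mapping (biholomorphic map) and let $\Phi_+:\mathbb D_+\to\Omega_+$ be the unique conformal bijection with $\Phi_+(\infty)=\infty$ and $\Phi_+'(\infty)>0$, i.e. $\Phi_+(z)=az+\sum_{m\ge0}a_mz^{-m}$ near $\infty$ with $a>0$. Both maps extend to homeomorphisms of the closures, and one sets $k=\Phi_+^{-1}\circ\Phi_-:\mathbb T\to\mathbb T$. Changing $\Phi_-$ replaces $k$ by $k\circ\phi$, where $\phi(z)=\lambda\frac{z-a}{1-\bar az}$, $|\lambda|=1$, $a\in\mathbb D$, is a Möbius automorphism of $\mathbb D$. The fingerprint of $\Gamma$ is the equivalence class of $k$ modulo such right compositions. "The fingerprint of $\Gamma$ is $k$" means that $k$ represents this class, i.e. $k=\Phi_+^{-1}\circ\Phi_-$ on $\mathbb T$ for a suitable choice of $\Phi_-$; two curves have the same fingerprint if these equivalence classes coincide. *)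

theory Defs
  imports "HOL-Complex_Analysis.Complex_Analysis"
begin

definition blaschke_product :: "real \<Rightarrow> (nat \<Rightarrow> complex) \<Rightarrow> nat \<Rightarrow> complex \<Rightarrow> complex" where
  "blaschke_product \<theta> a n z = cis \<theta> * (\<Prod>j=1..n. (z - a j) / (1 - cnj (a j) * z))"

definition proper_lemniscate :: "nat \<Rightarrow> complex set \<Rightarrow> bool" where
  "proper_lemniscate n \<Gamma> \<longleftrightarrow>
     (\<exists>P :: complex poly. degree P = n \<and>
        \<Gamma> = {z. norm (poly P z) = 1} \<and>
        (\<forall>z\<in>\<Gamma>. poly (pderiv P) z \<noteq> 0) \<and>
        connected {z. norm (poly P z) < 1})"

text \<open>
  The image of a regular \<open>C\<^sup>1\<close> parametrization of the circle, written as a loop on \<open>[0,1]\<close>. The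
  derivatives at the two ends have to agree, since otherwise a corner at the base point would
  be allowed. The derivatives at \<open>0\<close> and \<open>1\<close> are two-sided; this is no restriction, as the values
  of \<open>\<gamma>\<close> outside \<open>[0,1]\<close> are arbitrary.
\<close>

definition C1_jordan_curve :: "complex set \<Rightarrow> bool" where
  "C1_jordan_curve \<Gamma> \<longleftrightarrow>
     (\<exists>\<gamma> :: real \<Rightarrow> complex.
        simple_path \<gamma> \<and> pathfinish \<gamma> = pathstart \<gamma> \<and> path_image \<gamma> = \<Gamma> \<and>
        \<gamma> C1_differentiable_on {0..1} \<and>
        (\<forall>t\<in>{0..1}. vector_derivative \<gamma> (at t) \<noteq> 0) \<and>
        vector_derivative \<gamma> (at 0) = vector_derivative \<gamma> (at 1))"

text \<open>
  A Riemann map \<open>f\<close> of the disc onto the bounded component \<open>inside \<Gamma>\<close> of the complement of \<open>\<Gamma>\<close>,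
  already extended to a homeomorphism of the closures, whose inverse is \<open>f'\<close>. For a Jordan
  curve every Riemann map has a unique such extension.
\<close>

definition interior_map ::
  "complex set \<Rightarrow> (complex \<Rightarrow> complex) \<Rightarrow> (complex \<Rightarrow> complex) \<Rightarrow> bool" where
  "interior_map \<Gamma> f f' \<longleftrightarrow>
     f holomorphic_on ball 0 1 \<and> bij_betw f (ball 0 1) (inside \<Gamma>) \<and>
     homeomorphism (cball 0 1) (closure (inside \<Gamma>)) f f'"

text \<open>
  The normalized conformal bijection \<open>g\<close> of the exterior domains in the Riemann sphere, again
  extended to the closures, with inverse \<open>g'\<close>. The common point \<open>\<infinity>\<close>, which is fixed, is left
  out of the domain and the range; that \<open>g\<close> is conformal there with positive derivative is
  expressed by its expansion \<open>g z = a z + c\<^sub>0 + c\<^sub>1 / z + \<dots>\<close> near \<open>\<infinity>\<close>, where \<open>a > 0\<close>.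
\<close>

definition exterior_map ::
  "complex set \<Rightarrow> (complex \<Rightarrow> complex) \<Rightarrow> (complex \<Rightarrow> complex) \<Rightarrow> bool" where
  "exterior_map \<Gamma> g g' \<longleftrightarrow>
     g holomorphic_on {z. norm z > 1} \<and>
     bij_betw g {z. norm z > 1} (- closure (inside \<Gamma>)) \<and>
     homeomorphism {z. norm z \<ge> 1} (closure (- closure (inside \<Gamma>))) g g' \<and>
     (\<exists>a c R. a > (0::real) \<and>
        (\<forall>z. norm z > R \<longrightarrow> (\<lambda>m. c m / z ^ m) sums (g z - complex_of_real a * z)))"

text \<open>
  Circle maps are represented by functions on the whole plane; only their values on the unit
  circle matter.
\<close>

definition welding_map :: "complex set \<Rightarrow> (complex \<Rightarrow> complex) \<Rightarrow> bool" where
  "welding_map \<Gamma> k \<longleftrightarrow>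
     (\<exists>f f' g g'. interior_map \<Gamma> f f' \<and> exterior_map \<Gamma> g g' \<and>
        (\<forall>z\<in>sphere 0 1. k z = g' (f z)))"

definition disc_automorphism :: "(complex \<Rightarrow> complex) \<Rightarrow> bool" where
  "disc_automorphism \<phi> \<longleftrightarrow>
     (\<exists>u a. norm u = 1 \<and> norm a < 1 \<and> (\<forall>z. \<phi> z = u * ((z - a) / (1 - cnj a * z))))"

definition moebius_related :: "(complex \<Rightarrow> complex) \<Rightarrow> (complex \<Rightarrow> complex) \<Rightarrow> bool" where
  "moebius_related k h \<longleftrightarrow>
     (\<exists>\<phi>. disc_automorphism \<phi> \<and> (\<forall>z\<in>sphere 0 1. h z = k (\<phi> z)))"

text \<open>
  All welding maps of a Jordan curve are related to each other, so that this is one equivalence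
  class; its elements are the circle maps representing the fingerprint.
\<close>

definition fingerprint :: "complex set \<Rightarrow> (complex \<Rightarrow> complex) set" where
  "fingerprint \<Gamma> = {h. \<exists>k. welding_map \<Gamma> k \<and> moebius_related k h}"

end

theory Submission
  imports Defs
begin

text \<open>
  Let \<open>r < 1\<close> bound the moduli of the zeros of \<open>B\<close>. Each Blaschke factor increases in modulus along
  rays outside the disc, so that for some \<open>s > 1\<close> and \<open>\<rho> > 1\<close>, depending only on \<open>r\<close> and the degree
  \<open>n\<close>, the set \<open>U\<close> of all \<open>z\<close> with \<open>|z| < s\<close> and \<open>|B z| < \<rho>\<close> is a star-shaped neighbourhood of the
  closed disc. If \<open>\<psi>\<close> is the Riemann map of \<open>U\<close> onto the disc that fixes the origin, then
  \<open>B = \<rho> B\<^sub>1 \<circ> \<psi>\<close> on \<open>U\<close>, where \<open>B\<^sub>1\<close> is a Blaschke product with the zeros \<open>\<psi> a\<^sub>j\<close>. By the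
  Schwarz lemma these are again bounded by \<open>r\<close>, so the step can be repeated with the same \<open>\<rho>\<close>, which
  gives \<open>B = \<rho>\<^sup>m B\<^sub>m \<circ> F\<^sub>m\<close> for injective maps \<open>F\<^sub>m\<close> of \<open>U\<close> into the disc. The rescaled maps
  \<open>\<rho>\<^bsup>m/n\<^esup> F\<^sub>m\<close> are uniformly bounded, and by the theorems of Montel and Hurwitz a subsequence tends
  to an injective map \<open>G\<close> with \<open>P \<circ> G = B\<close> for a polynomial \<open>P\<close> of degree \<open>n\<close>. Hence \<open>G\<close> is a Riemann
  map of the lemniscate domain \<open>|P| < 1\<close> that extends across the circle.

  The exterior of the lemniscate \<open>\<Gamma>\<close> is simply connected in the sphere and free of zeros of \<open>P\<close>, so
  \<open>P = q\<^sup>n\<close> there, and \<open>q\<close> is the inverse of the exterior map. On the circle \<open>q \<circ> G\<close> and \<open>k\<close> are both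
  continuous \<open>n\<close>-th roots of \<open>B\<close>, hence equal up to a constant, which a rotation removes.

  For a second curve with the same fingerprint, the interior and exterior maps of both curves are
  glued along \<open>\<Gamma>\<close> to a continuous function on the plane that is holomorphic off \<open>\<Gamma>\<close>. It is entire,
  since \<open>\<Gamma>\<close> is analytic, and it grows linearly, so it is affine.
\<close>

section \<open>Boundary behaviour in the disc\<close>

lemma Riemann_map_centred:
  assumes S: "open S" "simply_connected S" "S \<noteq> UNIV" and a: "a \<in> S"
  obtains \<psi> h where "\<psi> holomorphic_on S" "h holomorphic_on ball 0 1"
    "\<psi> ` S = ball 0 1" "h ` ball 0 1 = S" "\<psi> a = 0" "h 0 = a"
    "\<And>z. z \<in> S \<Longrightarrow> h (\<psi> z) = z" "\<And>z. z \<in> ball 0 1 \<Longrightarrow> \<psi> (h z) = z"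
proof -
  obtain f g where f: "f holomorphic_on S" and g: "g holomorphic_on ball 0 1"
    and fg: "\<And>z. z \<in> S \<Longrightarrow> f z \<in> ball 0 1 \<and> g (f z) = z"
    and gf: "\<And>z. z \<in> ball 0 1 \<Longrightarrow> g z \<in> S \<and> f (g z) = z"
    using S a simply_connected_eq_biholomorphic_to_disc[OF S(1)] by (metis empty_iff)
  have "f a \<in> ball 0 1"
    using fg a by blast
  then obtain p q where pq: "p (f a) = 0" "p holomorphic_on ball 0 1" "p ` ball 0 1 \<subseteq> ball 0 1"
      "q holomorphic_on ball 0 1" "q ` ball 0 1 \<subseteq> ball 0 1"
      "\<And>z. z \<in> ball 0 1 \<Longrightarrow> p (q z) = z" "\<And>z. z \<in> ball 0 1 \<Longrightarrow> q (p z) = z"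
    using ball_biholomorphism_exists by blast
  have p_in: "p z \<in> ball 0 1" if "z \<in> ball 0 1" for z
    using pq(3) that by blast
  have q_in: "q z \<in> ball 0 1" if "z \<in> ball 0 1" for z
    using pq(5) that by blast
  show thesis
  proof (rule that[of "p \<circ> f" "g \<circ> q"])
    show "p \<circ> f holomorphic_on S"
      by (rule holomorphic_on_compose_gen[OF f pq(2)]) (use fg in blast)
    show "g \<circ> q holomorphic_on ball 0 1"
      by (rule holomorphic_on_compose_gen[OF pq(4) g pq(5)])
    show 1: "(g \<circ> q) ((p \<circ> f) z) = z" if "z \<in> S" for z
      using fg[OF that] pq(7) by simp
    show 2: "(p \<circ> f) ((g \<circ> q) z) = z" if "z \<in> ball 0 1" for z
      using gf[OF q_in[OF that]] pq(6)[OF that] by simp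
    have 3: "(p \<circ> f) ` S \<subseteq> ball 0 1" "(g \<circ> q) ` ball 0 1 \<subseteq> S"
      using fg gf p_in q_in by (auto simp del: mem_ball)
    show "(p \<circ> f) ` S = ball 0 1" "(g \<circ> q) ` ball 0 1 = S"
      using 1 2 3 by (force simp del: o_apply mem_ball)+
    show "(p \<circ> f) a = 0" using pq by simp
    then show "(g \<circ> q) 0 = a"
      using 1[OF a] by simp
  qed
qed

text \<open>Approach to the unit circle from inside, uniformly in the argument. Limits of moduli
  along this filter replace boundary values of Riemann maps.\<close>

abbreviation to_circle :: "complex filter" where
  "to_circle \<equiv> filtercomap norm (at_left 1)"

lemma eventually_to_circle:
  "eventually P to_circle \<longleftrightarrow> (\<exists>t<1. \<forall>z. t < norm z \<and> norm z < 1 \<longrightarrow> P z)"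
proof
  assume "eventually P to_circle"
  then show "\<exists>t<1. \<forall>z. t < norm z \<and> norm z < 1 \<longrightarrow> P z"
    unfolding eventually_filtercomap eventually_at_left_field by blast
next
  assume "\<exists>t<1. \<forall>z. t < norm z \<and> norm z < 1 \<longrightarrow> P z"
  then obtain t where t: "t < 1" "\<forall>z. t < norm z \<and> norm z < 1 \<longrightarrow> P z"
    by blast
  show "eventually P to_circle"
    unfolding eventually_filtercomap eventually_at_left_field
    by (rule exI[of _ "\<lambda>x. t < x \<and> x < 1"]) (use t in blast)
qed

lemma eventually_to_circle_in_ball: "eventually (\<lambda>z. z \<in> ball 0 1) to_circle"
  unfolding eventually_to_circle by (rule exI[of _ 0]) auto

lemma compact_ball_subset_cball:
  assumes "compact K" "K \<subseteq> ball (0::complex) 1"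
  obtains t where "0 \<le> t" "t < 1" "K \<subseteq> cball 0 t"
proof (cases "K = {}")
  case True
  then show ?thesis using that[of 0] by auto
next
  case False
  then obtain z where "z \<in> K" "\<And>y. y \<in> K \<Longrightarrow> norm y \<le> norm z"
    using continuous_attains_sup[OF assms(1) False continuous_on_norm[OF continuous_on_id]] by auto
  then show ?thesis
    using assms(2) that[of "norm z"] by force
qed

text \<open>This is properness of a Riemann map: the image of \<open>K\<close> under
  \<open>\<psi>\<close> lies in a disc of radius \<open>t < 1\<close>, so no \<open>z\<close> with
  \<open>|z| > t\<close> has \<open>h z\<close> in \<open>K\<close>.\<close>

lemma eventually_avoids_compact:
  assumes \<psi>: "continuous_on S \<psi>" "\<psi> ` S \<subseteq> ball 0 1"
    and \<psi>h: "\<And>z. z \<in> ball 0 1 \<Longrightarrow> \<psi> (h z) = z"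
    and K: "compact K" "K \<subseteq> S"
  shows "eventually (\<lambda>z. h z \<notin> K) to_circle"
proof -
  have "compact (\<psi> ` K)"
    using K \<psi>(1) by (metis compact_continuous_image continuous_on_subset)
  moreover have "\<psi> ` K \<subseteq> ball 0 1"
    using K(2) \<psi>(2) by blast
  ultimately obtain t where t: "0 \<le> t" "t < 1" "\<psi> ` K \<subseteq> cball 0 t"
    using compact_ball_subset_cball by blast
  show ?thesis
    unfolding eventually_to_circle
    using t \<psi>h by (intro exI[of _ t]) force
qed

lemma norm_le_of_tendsto_circle:
  assumes f: "f holomorphic_on ball 0 1" and lim: "((\<lambda>z. norm (f z)) \<longlongrightarrow> 1) to_circle"
    and z: "z \<in> ball 0 1"
  shows "norm (f z) \<le> 1"
proof (rule field_le_epsilon)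
  fix e :: real assume "e > 0"
  then have "eventually (\<lambda>z. norm (f z) < 1 + e) to_circle"
    using order_tendstoD(2)[OF lim] by simp
  then obtain t where t: "t < 1" "\<forall>w. t < norm w \<and> norm w < 1 \<longrightarrow> norm (f w) < 1 + e"
    unfolding eventually_to_circle by blast
  have "max t (norm z) < 1"
    using t(1) z by simp
  then obtain s where s: "max t (norm z) < s" "s < 1"
    using dense by blast
  have "s > 0"
    using s(1) norm_ge_zero[of z] by linarith
  show "norm (f z) \<le> 1 + e"
  proof (rule maximum_modulus_frontier[of f "ball 0 s"])
    show "f holomorphic_on interior (ball 0 s)"
      using f s by (auto intro: holomorphic_on_subset)
    show "continuous_on (closure (ball 0 s)) f"
      using f s \<open>s > 0\<close> by (intro holomorphic_on_imp_continuous_on) (auto intro: holomorphic_on_subset)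
    show "norm (f w) \<le> 1 + e" if "w \<in> frontier (ball 0 s)" for w
      using that t(2) s \<open>s > 0\<close> by (auto simp: frontier_ball)
  qed (use s in auto)
qed

text \<open>The maximum principle bounds both \<open>f\<close> and its reciprocal by 1. Applied to a
  quotient of functions with the same zeros and boundary moduli, this identifies Blaschke
  products.\<close>

lemma unimodular_boundary_imp_constant:
  assumes f: "f holomorphic_on ball 0 1" and nz: "\<And>z. z \<in> ball 0 1 \<Longrightarrow> f z \<noteq> 0"
    and lim: "((\<lambda>z. norm (f z)) \<longlongrightarrow> 1) to_circle"
  obtains u where "norm u = 1" "\<And>z. z \<in> ball 0 1 \<Longrightarrow> f z = u"
proof -
  have "((\<lambda>z. norm (inverse (f z))) \<longlongrightarrow> 1) to_circle"
    using tendsto_inverse[OF lim] by (simp add: norm_inverse)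
  then have inv: "norm (inverse (f z)) \<le> 1" if "z \<in> ball 0 1" for z
    by (intro norm_le_of_tendsto_circle) (use f nz that in \<open>auto intro!: holomorphic_intros\<close>)
  have n1: "norm (f z) = 1" if "z \<in> ball 0 1" for z
    using norm_le_of_tendsto_circle[OF f lim that] inv[OF that] nz[OF that]
    by (auto simp add: norm_inverse inverse_le_1_iff)
  have "f constant_on ball 0 1"
    by (rule maximum_modulus_principle[OF f, of "ball 0 1" 0]) (use n1 in auto)
  then show ?thesis
    using that n1 by (metis constant_on_def centre_in_ball zero_less_one)
qed

text \<open>\<open>k\<close> is the difference quotient at \<open>b\<close>, completed by the
  derivative; injectivity keeps both from vanishing.\<close>

lemma injective_holomorphic_factor:
  assumes f: "f holomorphic_on S" and S: "open S" and inj: "inj_on f S" and b: "b \<in> S"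
  obtains k where "k holomorphic_on S" "\<And>z. z \<in> S \<Longrightarrow> k z \<noteq> 0"
    "\<And>z. z \<in> S \<Longrightarrow> f z - f b = (z - b) * k z"
proof
  let ?k = "\<lambda>z. if z = b then deriv f b else (f z - f b) / (z - b)"
  show "?k holomorphic_on S"
    by (rule pole_lemma_open[OF f S])
  show "?k z \<noteq> 0" if "z \<in> S" for z
    using that b inj holomorphic_injective_imp_regular[OF f S inj b] by (auto dest: inj_onD)
  show "f z - f b = (z - b) * ?k z" if "z \<in> S" for z
    by simp
qed

section \<open>Blaschke factors\<close>

definition blaschke_factor :: "complex \<Rightarrow> complex \<Rightarrow> complex" where
  "blaschke_factor a z = (z - a) / (1 - cnj a * z)"

lemma blaschke_product_eq:
  "blaschke_product \<theta> a n z = cis \<theta> * (\<Prod>j=1..n. blaschke_factor (a j) z)"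
  by (simp add: blaschke_product_def blaschke_factor_def)

lemma norm_square_diff:
  "(norm (1 - cnj a * z))\<^sup>2 - (norm (z - a))\<^sup>2 = (1 - (norm a)\<^sup>2) * (1 - (norm z)\<^sup>2)"
  unfolding cmod_power2 by (simp add: power2_eq_square) algebra

lemma blaschke_denominator_lower:
  "norm (1 - cnj a * z) \<ge> 1 - norm a * norm z"
  using norm_triangle_ineq2[of 1 "cnj a * z"] by (simp add: norm_mult)

lemma blaschke_denominator_nonzero: "norm a * norm z < 1 \<Longrightarrow> 1 - cnj a * z \<noteq> 0"
  using blaschke_denominator_lower[of a z] by fastforce

lemma norm_blaschke_factor_square:
  assumes "norm a * norm z < 1"
  shows "(norm (blaschke_factor a z))\<^sup>2
           = 1 - (1 - (norm a)\<^sup>2) * (1 - (norm z)\<^sup>2) / (norm (1 - cnj a * z))\<^sup>2"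
  using norm_square_diff[of a z] blaschke_denominator_nonzero[OF assms]
  by (simp add: blaschke_factor_def norm_divide power_divide field_simps)

lemma blaschke_factor_less_1:
  assumes "norm a < 1" "norm z < 1"
  shows "norm (blaschke_factor a z) < 1"
proof -
  have 1: "norm a * norm z < 1"
    using assms by (metis mult_strict_mono norm_ge_zero zero_less_one mult_1)
  have "(1 - (norm a)\<^sup>2) * (1 - (norm z)\<^sup>2) / (norm (1 - cnj a * z))\<^sup>2 > 0"
    using assms blaschke_denominator_nonzero[OF 1]
    by (intro divide_pos_pos mult_pos_pos) (auto simp: abs_square_less_1)
  then have "(norm (blaschke_factor a z))\<^sup>2 < 1"
    using norm_blaschke_factor_square[OF 1] by simp
  then show ?thesis
    by (simp add: abs_square_less_1)
qed

lemma blaschke_factor_eq_1: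
  assumes "norm a < 1" "norm z = 1"
  shows "norm (blaschke_factor a z) = 1"
proof -
  have "(norm (blaschke_factor a z))\<^sup>2 = 1"
    using norm_blaschke_factor_square[of a z] assms by simp
  then show ?thesis
    by (metis norm_ge_zero power2_eq_1_iff neg_0_le_iff_le not_one_le_zero)
qed

text \<open>On the circle \<open>|z| = s\<close> the modulus is smallest opposite to
  \<open>a\<close>, where it equals \<open>(s + |a|) / (1 + |a| s)\<close>, and this does not
  increase with \<open>|a|\<close>.\<close>

lemma blaschke_factor_ge:
  assumes r: "norm a \<le> r" "r < 1" "r * s < 1" and s: "1 \<le> s" "norm z = s"
  shows "(s + r) / (1 + r * s) \<le> norm (blaschke_factor a z)"
proof -
  define \<alpha> where "\<alpha> = norm a"
  have "norm a * s \<le> r * s"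
    using r s by (intro mult_right_mono) auto
  then have \<alpha>: "0 \<le> \<alpha>" "\<alpha> \<le> r" "\<alpha> * s < 1"
    using r by (auto simp: \<alpha>_def)
  have "0 \<le> r" using \<alpha> by linarith
  have 1: "norm a * norm z < 1"
    using \<alpha> s by (simp add: \<alpha>_def)
  have pos: "norm (1 - cnj a * z) > 0"
    using blaschke_denominator_nonzero[OF 1] by simp
  have "norm (1 - cnj a * z) \<le> 1 + \<alpha> * s"
    using norm_triangle_ineq4[of 1 "cnj a * z"] s by (simp add: norm_mult \<alpha>_def)
  then have le: "(norm (1 - cnj a * z))\<^sup>2 \<le> (1 + \<alpha> * s)\<^sup>2"
    by (simp add: power_mono)
  have nn: "0 \<le> (1 - \<alpha>\<^sup>2) * (s\<^sup>2 - 1)"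
    using s \<alpha> r by (intro mult_nonneg_nonneg) (auto simp: abs_square_le_1)
  have p: "0 < 1 + \<alpha> * s" using \<alpha> s by (smt (verit) mult_nonneg_nonneg)
  have "(s + \<alpha>)\<^sup>2 = (1 + \<alpha> * s)\<^sup>2 + (1 - \<alpha>\<^sup>2) * (s\<^sup>2 - 1)"
    by algebra
  then have "((s + \<alpha>) / (1 + \<alpha> * s))\<^sup>2 = 1 + (1 - \<alpha>\<^sup>2) * (s\<^sup>2 - 1) / (1 + \<alpha> * s)\<^sup>2"
    using p unfolding power_divide by (simp add: divide_simps)
  also have "\<dots> \<le> 1 + (1 - \<alpha>\<^sup>2) * (s\<^sup>2 - 1) / (norm (1 - cnj a * z))\<^sup>2"
    using divide_left_mono[OF le nn] pos p by simp
  also have "\<dots> = (norm (blaschke_factor a z))\<^sup>2"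
  proof -
    have "(1 - \<alpha>\<^sup>2) * (s\<^sup>2 - 1) = - ((1 - \<alpha>\<^sup>2) * (1 - s\<^sup>2))"
      by (simp add: algebra_simps)
    then show ?thesis
      unfolding norm_blaschke_factor_square[OF 1] s(2) \<alpha>_def by simp
  qed
  finally have "(s + \<alpha>) / (1 + \<alpha> * s) \<le> norm (blaschke_factor a z)"
    by (rule power2_le_imp_le) simp
  moreover have "(s + r) / (1 + r * s) \<le> (s + \<alpha>) / (1 + \<alpha> * s)"
  proof -
    have "0 \<le> (r - \<alpha>) * (s\<^sup>2 - 1)"
      using \<alpha> s by (intro mult_nonneg_nonneg) auto
    moreover have "0 < 1 + r * s" using \<open>0 \<le> r\<close> s by (smt (verit) mult_nonneg_nonneg)
    ultimately show ?thesis
      using p by (simp add: field_simps power2_eq_square)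
  qed
  ultimately show ?thesis by linarith
qed

text \<open>The squared modulus is \<open>1 + (1 - |a|^2) (|z|^2 - 1) / |1 - cnj a z|^2\<close>, so
  it suffices that the last quotient grows along the ray. This is what makes the collar domain
  star-shaped.\<close>

lemma norm_blaschke_factor_radial_mono:
  assumes az: "norm a * norm z < 1" and t: "0 \<le> t" "t \<le> 1" "1 \<le> t * norm z" "norm a < 1"
  shows "norm (blaschke_factor a (of_real t * z)) \<le> norm (blaschke_factor a z)"
proof -
  define c where "c = cnj a * z"
  define x where "x = Re c"
  define m where "m = (norm c)\<^sup>2"
  define N where "N = (norm z)\<^sup>2"
  have nt: "norm (of_real t * z) = t * norm z"
    using t by (simp add: norm_mult)
  have az': "norm a * norm (of_real t * z) < 1"
    unfolding nt using az t by (smt (verit, ccfv_SIG) mult_left_le_one_le mult_left_mono norm_ge_zero zero_le_mult_iff)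
  have z1: "norm z \<ge> 1"
    using t by (smt (verit) mult_left_le_one_le norm_ge_zero)
  have N1: "N \<ge> 1" unfolding N_def using z1 by simp
  have m: "x\<^sup>2 \<le> m" unfolding m_def x_def cmod_power2 by simp
  have "norm c < 1" unfolding c_def using az by (simp add: norm_mult)
  then have x1: "x < 1" unfolding x_def using complex_Re_le_cmod[of c] by linarith
  have d1: "(norm (1 - cnj a * z))\<^sup>2 = 1 - 2 * x + m"
    unfolding c_def[symmetric] m_def x_def cmod_power2 by (simp add: power2_eq_square algebra_simps)
  have d2: "(norm (1 - cnj a * (of_real t * z)))\<^sup>2 = 1 - 2 * t * x + t\<^sup>2 * m"
  proof -
    have eq: "cnj a * (of_real t * z) = of_real t * c" by (simp add: c_def)
    show ?thesis
      unfolding eq m_def x_def cmod_power2 by (simp add: power2_eq_square algebra_simps)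
  qed
  have p1: "(norm (1 - cnj a * z))\<^sup>2 > 0" "(norm (1 - cnj a * (of_real t * z)))\<^sup>2 > 0"
    using blaschke_denominator_nonzero[OF az] blaschke_denominator_nonzero[OF az'] by auto
  have key: "(t\<^sup>2 * N - 1) * (1 - 2 * x + m) \<le> (N - 1) * (1 - 2 * t * x + t\<^sup>2 * m)"
  proof -
    \<comment> \<open>The difference of the two sides of \<open>key\<close>, arranged into terms
      that are nonnegative by \<open>x < 1\<close>, \<open>1 \<le> N\<close> and
      \<open>x^2 \<le> m\<close>.\<close>
    have "0 \<le> (1 - t) * ((1 - t) * ((N - 1) + (1 - x)\<^sup>2) + 2 * t * ((1 - x) * (N - x)) + (m - x\<^sup>2) * (1 + t))"
      using t N1 x1 m by (intro mult_nonneg_nonneg add_nonneg_nonneg) auto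
    also have "\<dots> = (N - 1) * (1 - 2 * t * x + t\<^sup>2 * m) - (t\<^sup>2 * N - 1) * (1 - 2 * x + m)"
      by algebra
    finally show ?thesis by simp
  qed
  have "(t\<^sup>2 * N - 1) / (norm (1 - cnj a * (of_real t * z)))\<^sup>2 \<le> (N - 1) / (norm (1 - cnj a * z))\<^sup>2"
    using key p1 unfolding d1 d2 by (simp add: divide_simps mult.commute)
  then have "(1 - (norm a)\<^sup>2) * ((t\<^sup>2 * N - 1) / (norm (1 - cnj a * (of_real t * z)))\<^sup>2)
      \<le> (1 - (norm a)\<^sup>2) * ((N - 1) / (norm (1 - cnj a * z))\<^sup>2)"
    by (rule mult_left_mono) (use t in \<open>simp add: abs_square_le_1\<close>)
  moreover have "(norm (blaschke_factor a z))\<^sup>2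
      = 1 + (1 - (norm a)\<^sup>2) * ((N - 1) / (norm (1 - cnj a * z))\<^sup>2)"
    unfolding norm_blaschke_factor_square[OF az] N_def
    using p1 by (simp add: field_simps)
  moreover have "(norm (blaschke_factor a (of_real t * z)))\<^sup>2
      = 1 + (1 - (norm a)\<^sup>2) * ((t\<^sup>2 * N - 1) / (norm (1 - cnj a * (of_real t * z)))\<^sup>2)"
    unfolding norm_blaschke_factor_square[OF az'] N_def nt
    using p1 by (simp add: field_simps power_mult_distrib)
  ultimately have "(norm (blaschke_factor a (of_real t * z)))\<^sup>2 \<le> (norm (blaschke_factor a z))\<^sup>2"
    by linarith
  then show ?thesis
    by (rule power2_le_imp_le) simp
qed

lemma norm_blaschke_factor_tendsto:
  assumes "norm b < 1"
  shows "((\<lambda>z. norm (blaschke_factor b z)) \<longlongrightarrow> 1) to_circle"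
proof -
  \<comment> \<open>\<open>?l\<close> results from \<open>|1 - cnj b z| \<ge> 1 - |b|\<close> in the
    formula for the squared modulus, which is squeezed between \<open>?l\<close> and 1.\<close>
  let ?l = "\<lambda>z::complex. 1 - (1 - (norm z)\<^sup>2) / (1 - norm b)\<^sup>2"
  have norm1: "(norm \<longlongrightarrow> 1) to_circle"
    using filterlim_filtercomap[of norm "at_left (1::real)"] filterlim_mono
    by (metis at_within_le_nhds order_refl)
  have "(?l \<longlongrightarrow> 1 - (1 - 1\<^sup>2) / (1 - norm b)\<^sup>2) to_circle"
    using assms by (intro tendsto_intros norm1) auto
  then have l: "(?l \<longlongrightarrow> 1) to_circle" by simp
  have "((\<lambda>z. (norm (blaschke_factor b z))\<^sup>2) \<longlongrightarrow> 1) to_circle"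
  proof (rule tendsto_sandwich[OF _ _ l tendsto_const])
    show "eventually (\<lambda>z. ?l z \<le> (norm (blaschke_factor b z))\<^sup>2) to_circle"
      using eventually_to_circle_in_ball
    proof (rule eventually_mono)
      fix z :: complex assume "z \<in> ball 0 1"
      then have z: "norm z < 1" by simp
      have "norm b * norm z \<le> norm b * 1"
        using z by (intro mult_left_mono) auto
      then have 1: "norm b * norm z < 1" "norm b * norm z \<le> norm b"
        using assms by auto
      have "1 - norm b \<le> norm (1 - cnj b * z)"
        using blaschke_denominator_lower[of b z] 1(2) by linarith
      then have "(1 - norm b)\<^sup>2 \<le> (norm (1 - cnj b * z))\<^sup>2"
        using assms by (intro power_mono) auto
      moreover have "(1 - (norm b)\<^sup>2) * (1 - (norm z)\<^sup>2) \<le> 1 - (norm z)\<^sup>2" "0 \<le> 1 - (norm z)\<^sup>2"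
        using z assms by (auto simp: abs_square_le_1 mult_left_le_one_le)
      ultimately have "(1 - (norm b)\<^sup>2) * (1 - (norm z)\<^sup>2) / (norm (1 - cnj b * z))\<^sup>2
          \<le> (1 - (norm z)\<^sup>2) / (1 - norm b)\<^sup>2"
        using assms by (intro frac_le) auto
      then show "?l z \<le> (norm (blaschke_factor b z))\<^sup>2"
        unfolding norm_blaschke_factor_square[OF 1(1)] by linarith
    qed
    show "eventually (\<lambda>z. (norm (blaschke_factor b z))\<^sup>2 \<le> 1) to_circle"
      using eventually_to_circle_in_ball
      by (rule eventually_mono) (use blaschke_factor_less_1[OF assms] in \<open>simp add: abs_square_le_1 less_imp_le\<close>)
  qed
  from tendsto_real_sqrt[OF this] show ?thesis by simp
qed

section \<open>One step of the exhaustion\<close>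

text \<open>In its use below, \<open>r * s < 1\<close> keeps the poles of \<open>B\<close> outside,
  and the lower bound for \<open>|B|\<close> on the circle \<open>|z| = s\<close> leaves only points
  with \<open>|B| = \<rho>\<close> on the boundary of the domain.\<close>

definition collar :: "real \<Rightarrow> (complex \<Rightarrow> complex) \<Rightarrow> real \<Rightarrow> complex set" where
  "collar s B \<rho> = {z. norm z < s \<and> norm (B z) < \<rho>}"

text \<open>\<open>\<rho>\<close> is the \<open>n\<close>-th power of the bound in
  \<open>blaschke_factor_ge\<close>. It involves the bound \<open>r\<close> but not the zeros
  themselves, so it stays the same through the iteration.\<close>

locale blaschke =
  fixes n :: nat and r s \<rho> :: real
  assumes n: "n \<ge> 1" and r: "0 < r" "r < 1" and s: "1 < s" "r * s < 1"
    and \<rho>: "\<rho> = ((s + r) / (1 + r * s)) ^ n"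
begin

lemma rho_gt_1: "\<rho> > 1"
proof -
  have "0 < (1 - r) * (s - 1)"
    using r s by (intro mult_pos_pos) auto
  then have "1 + r * s < s + r"
    by (simp add: algebra_simps)
  moreover have "0 < 1 + r * s" using r s by (simp add: add_pos_pos)
  ultimately have "(s + r) / (1 + r * s) > 1"
    by simp
  then show ?thesis
    unfolding \<rho> using n by (simp add: one_less_power)
qed

section \<open>Blaschke products on the collar domain\<close>

context
  fixes a :: "nat \<Rightarrow> complex" and \<theta> :: real and B :: "complex \<Rightarrow> complex"
  assumes a: "\<And>j. j \<in> {1..n} \<Longrightarrow> norm (a j) \<le> r" and B: "B = blaschke_product \<theta> a n"
begin

lemma zeros_less_1: "j \<in> {1..n} \<Longrightarrow> norm (a j) < 1"
  using a r(2) by (meson le_less_trans)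

lemma zeros_mult_less_1:
  assumes "j \<in> {1..n}" "norm z \<le> s"
  shows "norm (a j) * norm z < 1"
proof -
  have "norm (a j) * norm z \<le> r * s"
    using a[OF assms(1)] assms(2) r s by (intro mult_mono) auto
  then show ?thesis using s by linarith
qed

lemma holomorphic_blaschke: "B holomorphic_on cball 0 s"
  unfolding B blaschke_product_eq blaschke_factor_def
  using zeros_mult_less_1 blaschke_denominator_nonzero
  by (intro holomorphic_intros) auto

lemma continuous_blaschke: "continuous_on (cball 0 s) B"
  using holomorphic_blaschke holomorphic_on_imp_continuous_on by blast

lemma norm_blaschke: "norm (B z) = (\<Prod>j=1..n. norm (blaschke_factor (a j) z))"
  unfolding B blaschke_product_eq by (simp add: norm_mult prod_norm)

lemma norm_blaschke_less_1: "norm z < 1 \<Longrightarrow> norm (B z) < 1"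
proof -
  assume z: "norm z < 1"
  have "(\<Prod>j=1..n. norm (blaschke_factor (a j) z)) < (\<Prod>j=1..n. 1)"
    using blaschke_factor_less_1[OF zeros_less_1 z] n
    by (intro prod_mono_strict[of 1]) (auto simp: less_imp_le)
  then show ?thesis unfolding norm_blaschke by simp
qed

lemma norm_blaschke_eq_1: "norm z = 1 \<Longrightarrow> norm (B z) = 1"
  unfolding norm_blaschke using blaschke_factor_eq_1[OF zeros_less_1] by simp

lemma norm_blaschke_ge:
  assumes "norm z = s"
  shows "\<rho> \<le> norm (B z)"
proof -
  have p: "0 \<le> (s + r) / (1 + r * s)"
    using r s by simp
  have "(\<Prod>j=1..n. (s + r) / (1 + r * s)) \<le> (\<Prod>j=1..n. norm (blaschke_factor (a j) z))"
    using blaschke_factor_ge[OF a r(2) s(2) _ assms] s p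
    by (intro prod_mono) auto
  then show ?thesis
    unfolding \<rho> norm_blaschke by simp
qed

lemma norm_blaschke_radial_mono:
  assumes "norm z < s" "0 \<le> t" "t \<le> 1" "1 \<le> t * norm z"
  shows "norm (B (of_real t * z)) \<le> norm (B z)"
  unfolding norm_blaschke
  using norm_blaschke_factor_radial_mono[OF zeros_mult_less_1] zeros_less_1 assms
  by (intro prod_mono) auto

lemma cball_subset_collar: "cball 0 1 \<subseteq> collar s B \<rho>"
  using norm_blaschke_less_1 norm_blaschke_eq_1 rho_gt_1 s
  unfolding collar_def by (force simp: le_less)

lemma collar_subset: "collar s B \<rho> \<subseteq> ball 0 s"
  by (auto simp: collar_def)

lemma open_collar: "open (collar s B \<rho>)"
proof -
  have "open (ball 0 s \<inter> (\<lambda>z. norm (B z)) -` {..<\<rho>})"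
    using continuous_blaschke
    by (intro continuous_open_preimage continuous_on_norm) (auto intro: continuous_on_subset)
  also have "ball 0 s \<inter> (\<lambda>z. norm (B z)) -` {..<\<rho>} = collar s B \<rho>"
    by (auto simp: collar_def)
  finally show ?thesis .
qed

lemma starlike_collar: "starlike (collar s B \<rho>)"
  unfolding starlike_def
proof (intro bexI[of _ 0] ballI subsetI)
  show "0 \<in> collar s B \<rho>"
    using cball_subset_collar by auto
next
  fix z w assume z: "z \<in> collar s B \<rho>" and "w \<in> closed_segment 0 z"
  then obtain t where t: "0 \<le> t" "t \<le> 1" "w = of_real t * z"
    by (auto simp: in_segment scaleR_conv_of_real)
  show "w \<in> collar s B \<rho>"
  proof (cases "norm w \<le> 1")
    case True
    then show ?thesis using cball_subset_collar by auto
  next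
    case False
    have "norm w \<le> norm z"
      using t by (simp add: norm_mult mult_left_le_one_le)
    moreover have "norm (B w) \<le> norm (B z)"
      using norm_blaschke_radial_mono[of z t] t z False
      by (auto simp: collar_def norm_mult)
    ultimately show ?thesis
      using z by (auto simp: collar_def)
  qed
qed

lemma simply_connected_collar: "simply_connected (collar s B \<rho>)"
  using starlike_collar by (rule starlike_imp_simply_connected)

lemma connected_collar: "connected (collar s B \<rho>)"
  using starlike_collar by (rule starlike_imp_connected)

text \<open>On the circle \<open>|z| = s\<close> the modulus is at least \<open>\<rho> > c\<close>,
  so the closed set in \<open>cball 0 s\<close> does not reach that circle. This makes
  \<open>B\<close> proper on the collar domain.\<close>

lemma compact_sublevel:
  assumes "c < \<rho>"
  shows "compact {z \<in> collar s B \<rho>. norm (B z) \<le> c}"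
proof -
  have "closed (cball 0 s \<inter> (\<lambda>z. norm (B z)) -` {..c})"
    using continuous_blaschke by (intro continuous_closed_preimage continuous_on_norm) auto
  moreover have "cball 0 s \<inter> (\<lambda>z. norm (B z)) -` {..c} = {z \<in> collar s B \<rho>. norm (B z) \<le> c}"
    using norm_blaschke_ge assms by (force simp: collar_def le_less)
  ultimately show ?thesis
    by (metis (no_types, lifting) bounded_cball bounded_Int compact_eq_bounded_closed)
qed

text \<open>
  The Riemann map \<open>h\<close> of the collar domain turns \<open>B / \<rho>\<close> into a proper self-map of the disc of
  degree \<open>n\<close>, which is again a Blaschke product.
\<close>

lemma blaschke_step:
  obtains \<psi> \<theta>' where "\<psi> holomorphic_on collar s B \<rho>" "inj_on \<psi> (collar s B \<rho>)"
    "\<psi> ` collar s B \<rho> \<subseteq> ball 0 1" "\<psi> 0 = 0" "\<And>j. j \<in> {1..n} \<Longrightarrow> norm (\<psi> (a j)) \<le> r"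
    "\<And>z. z \<in> collar s B \<rho> \<Longrightarrow> B z = of_real \<rho> * blaschke_product \<theta>' (\<psi> \<circ> a) n (\<psi> z)"
proof -
  let ?U = "collar s B \<rho>"
  have U0: "0 \<in> ?U" and UNIV: "?U \<noteq> UNIV"
    using cball_subset_collar collar_subset s(1)
    by (auto simp: subset_eq dest: bspec[of _ _ "of_real s"])
  obtain \<psi> h where \<psi>: "\<psi> holomorphic_on ?U" "\<psi> ` ?U = ball 0 1" "\<psi> 0 = 0"
    and h: "h holomorphic_on ball 0 1" "h ` ball 0 1 = ?U" "h 0 = 0"
    and h\<psi>: "\<And>z. z \<in> ?U \<Longrightarrow> h (\<psi> z) = z" and \<psi>h: "\<And>z. z \<in> ball 0 1 \<Longrightarrow> \<psi> (h z) = z"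
    using Riemann_map_centred[OF open_collar simply_connected_collar UNIV U0] by metis
  have injh: "inj_on h (ball 0 1)"
    using \<psi>h by (metis inj_onI)
  have hU: "h z \<in> ?U" if "z \<in> ball 0 1" for z
    using h(2) that by blast
  have aU: "a j \<in> ?U" if "j \<in> {1..n}" for j
    using zeros_less_1[OF that] cball_subset_collar by auto
  have b1: "\<psi> (a j) \<in> ball 0 1" if "j \<in> {1..n}" for j
    using \<psi>(2) aU[OF that] by blast
  \<comment> \<open>\<open>\<psi>\<close> maps the unit disc into itself and fixes the origin, so by
    the Schwarz lemma no zero moves outward.\<close>
  have br: "norm (\<psi> (a j)) \<le> r" if j: "j \<in> {1..n}" for j
  proof -
    have "norm (\<psi> (a j)) \<le> norm (a j)"
    proof (rule Schwarz_Lemma(1))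
      show "\<psi> holomorphic_on ball 0 1"
        using \<psi>(1) cball_subset_collar by (meson ball_subset_cball holomorphic_on_subset order_trans)
      show "norm (\<psi> z) < 1" if "norm z < 1" for z
        using \<psi>(2) cball_subset_collar that by (force simp: subset_eq)
    qed (use \<psi>(3) zeros_less_1[OF j] in auto)
    then show ?thesis using a[OF j] by linarith
  qed
  \<comment> \<open>\<open>h\<close> is univalent with \<open>h (\<psi> (a j)) = a j\<close>, so
    each factor of \<open>B \<circ> h\<close> is a Blaschke factor at \<open>\<psi> (a j)\<close>
    times a zero-free function.\<close>
  have "\<exists>q. q holomorphic_on ball 0 1 \<and> (\<forall>z\<in>ball 0 1. q z \<noteq> 0 \<and>
          blaschke_factor (a j) (h z) = q z * blaschke_factor (\<psi> (a j)) z)" if j: "j \<in> {1..n}" for j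
  proof -
    obtain k where k: "k holomorphic_on ball 0 1" "\<And>z. z \<in> ball 0 1 \<Longrightarrow> k z \<noteq> 0"
      "\<And>z. z \<in> ball 0 1 \<Longrightarrow> h z - h (\<psi> (a j)) = (z - \<psi> (a j)) * k z"
      using injective_holomorphic_factor[OF h(1) open_ball injh b1[OF j]] by blast
    let ?q = "\<lambda>z. k z * (1 - cnj (\<psi> (a j)) * z) / (1 - cnj (a j) * h z)"
    have d1: "1 - cnj (a j) * h z \<noteq> 0" if "z \<in> ball 0 1" for z
      using hU[OF that] j by (intro blaschke_denominator_nonzero zeros_mult_less_1) (auto simp: collar_def)
    have d2: "1 - cnj (\<psi> (a j)) * z \<noteq> 0" if "z \<in> ball 0 1" for z
    proof (rule blaschke_denominator_nonzero)
      have "norm (\<psi> (a j)) * norm z \<le> 1 * norm z"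
        using b1[OF j] by (intro mult_right_mono) auto
      then show "norm (\<psi> (a j)) * norm z < 1" using that by simp
    qed
    have "?q holomorphic_on ball 0 1"
      using k(1) h(1) d1 by (intro holomorphic_intros) auto
    moreover have "?q z \<noteq> 0 \<and> blaschke_factor (a j) (h z) = ?q z * blaschke_factor (\<psi> (a j)) z"
      if z: "z \<in> ball 0 1" for z
    proof -
      have "h z - a j = (z - \<psi> (a j)) * k z"
        using k(3)[OF z] h\<psi>[OF aU[OF j]] by simp
      then show ?thesis
        using k(2)[OF z] d1[OF z] d2[OF z] by (simp add: blaschke_factor_def)
    qed
    ultimately show ?thesis by blast
  qed
  then obtain q where q: "\<And>j. j \<in> {1..n} \<Longrightarrow> q j holomorphic_on ball 0 1"
    "\<And>j z. j \<in> {1..n} \<Longrightarrow> z \<in> ball 0 1 \<Longrightarrow> q j z \<noteq> 0"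
    "\<And>j z. j \<in> {1..n} \<Longrightarrow> z \<in> ball 0 1 \<Longrightarrow>
       blaschke_factor (a j) (h z) = q j z * blaschke_factor (\<psi> (a j)) z"
    by metis
  \<comment> \<open>\<open>Q\<close> is \<open>B \<circ> h / \<rho>\<close> divided by the Blaschke
    factors at the points \<open>\<psi> (a j)\<close>. It has no zeros and boundary modulus 1, hence
    it is a unimodular constant.\<close>
  define Q where "Q z = cis \<theta> * (\<Prod>j=1..n. q j z) / of_real \<rho>" for z
  have BQ: "B (h z) = of_real \<rho> * Q z * (\<Prod>j=1..n. blaschke_factor (\<psi> (a j)) z)"
    if "z \<in> ball 0 1" for z
    unfolding B blaschke_product_eq Q_def using q(3) that rho_gt_1
    by (simp add: prod.distrib)
  have prod1: "((\<lambda>z. \<Prod>j=1..n. norm (blaschke_factor (\<psi> (a j)) z)) \<longlongrightarrow> 1) to_circle"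
  proof -
    have "((\<lambda>z. \<Prod>j=1..n. norm (blaschke_factor (\<psi> (a j)) z)) \<longlongrightarrow> (\<Prod>j=1..n. 1)) to_circle"
      by (intro tendsto_prod norm_blaschke_factor_tendsto) (use b1 in auto)
    then show ?thesis by simp
  qed
  \<comment> \<open>As \<open>z\<close> tends to the circle, \<open>h z\<close> leaves each compact
    set \<open>|B| \<le> c\<close> with \<open>c < \<rho>\<close>, while \<open>|B| < \<rho>\<close>
    throughout the domain.\<close>
  have Bh: "((\<lambda>z. norm (B (h z))) \<longlongrightarrow> \<rho>) to_circle"
  proof (rule order_tendstoI)
    fix c assume "c < \<rho>"
    let ?K = "{z \<in> ?U. norm (B z) \<le> c}"
    have "eventually (\<lambda>z. h z \<notin> ?K) to_circle"
      using \<psi> \<psi>h compact_sublevel[OF \<open>c < \<rho>\<close>]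
      by (intro eventually_avoids_compact[of ?U \<psi>] holomorphic_on_imp_continuous_on) auto
    then show "eventually (\<lambda>z. c < norm (B (h z))) to_circle"
      using eventually_to_circle_in_ball by eventually_elim (use hU in force)
  next
    fix c assume "\<rho> < c"
    show "eventually (\<lambda>z. norm (B (h z)) < c) to_circle"
      using eventually_to_circle_in_ball
      by eventually_elim (use hU \<open>\<rho> < c\<close> in \<open>force simp: collar_def\<close>)
  qed
  have "((\<lambda>z. norm (B (h z)) / (\<Prod>j=1..n. norm (blaschke_factor (\<psi> (a j)) z)) / \<rho>)
          \<longlongrightarrow> \<rho> / 1 / \<rho>) to_circle"
    using rho_gt_1 by (intro tendsto_divide Bh prod1 tendsto_const) auto
  moreover have "eventually (\<lambda>z. norm (B (h z)) / (\<Prod>j=1..n. norm (blaschke_factor (\<psi> (a j)) z)) / \<rho>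
                    = norm (Q z)) to_circle"
    using eventually_to_circle_in_ball order_tendstoD(1)[OF prod1 zero_less_one]
    by eventually_elim (use BQ rho_gt_1 in \<open>simp add: norm_mult prod_norm\<close>)
  ultimately have Qlim: "((\<lambda>z. norm (Q z)) \<longlongrightarrow> 1) to_circle"
    using rho_gt_1 by (force elim: Lim_transform_eventually)
  have Q0: "Q z \<noteq> 0" if "z \<in> ball 0 1" for z
    using q(2)[OF _ that] rho_gt_1 by (simp add: Q_def)
  have "Q holomorphic_on ball 0 1"
    unfolding Q_def using q(1) rho_gt_1 by (intro holomorphic_intros) auto
  then obtain u where u: "norm u = 1" "\<And>z. z \<in> ball 0 1 \<Longrightarrow> Q z = u"
    using unimodular_boundary_imp_constant[OF _ Q0 Qlim] by blast
  have "u \<noteq> 0"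
    using u(1) by auto
  then have "u = cis (Arg u)"
    using u(1) cis_Arg[of u] by (simp add: sgn_eq)
  then obtain \<theta>' where \<theta>': "u = cis \<theta>'"
    by blast
  show thesis
  proof (rule that[of \<psi> \<theta>'])
    show "inj_on \<psi> ?U"
      using h\<psi> by (metis inj_onI)
    show "B z = of_real \<rho> * blaschke_product \<theta>' (\<psi> \<circ> a) n (\<psi> z)" if "z \<in> ?U" for z
    proof -
      have "\<psi> z \<in> ball 0 1" using \<psi>(2) that by blast
      from BQ[OF this] u(2)[OF this] show ?thesis
        unfolding blaschke_product_eq \<theta>' h\<psi>[OF that] by simp
    qed
  qed (use \<psi> br in auto)
qed

end

end

section \<open>The polynomial as a limit of rational functions\<close>

text \<open>If \<open>|x|\<close> were larger, connectedness would give points of \<open>S\<close>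
  with the \<open>card I + 1\<close> moduli \<open>2 M i\<close>. Two of them share a ball of radius
  \<open>M\<close>, although their moduli differ by at least \<open>2 M\<close>.\<close>

lemma connected_covered_by_balls_bound:
  fixes S :: "complex set"
  assumes S: "connected S" "0 \<in> S" and I: "finite I" and M: "M > 0"
    and cov: "\<And>x. x \<in> S \<Longrightarrow> \<exists>j\<in>I. norm (x - c j) < M" and x: "x \<in> S"
  shows "norm x < 2 * M * real (card I)"
proof (rule ccontr)
  assume "\<not> norm x < 2 * M * real (card I)"
  then have big: "2 * M * real (card I) \<le> norm x" by simp
  have conn: "connected (norm ` S)"
    using S(1) by (intro connected_continuous_image continuous_intros)
  have "\<exists>y\<in>S. norm y = 2 * M * real i" if "i \<le> card I" for i
  proof -
    have "2 * M * real i \<le> 2 * M * real (card I)"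
      using that M by (intro mult_left_mono) auto
    then have "2 * M * real i \<le> norm x"
      using big by linarith
    moreover have "0 \<in> norm ` S" "norm x \<in> norm ` S"
      using imageI[OF S(2), of norm] imageI[OF x, of norm] by simp_all
    ultimately have "2 * M * real i \<in> norm ` S"
      using M by (elim connectedD_interval[OF conn, of 0 "norm x", rotated 3]) simp_all
    then show ?thesis by (metis imageE)
  qed
  then have "\<forall>i\<in>{..card I}. \<exists>y. y \<in> S \<and> norm y = 2 * M * real i"
    by blast
  from bchoice[OF this] obtain y
    where y: "\<forall>i\<in>{..card I}. y i \<in> S \<and> norm (y i) = 2 * M * real i"
    by blast
  then have "\<forall>i\<in>{..card I}. \<exists>j. j \<in> I \<and> norm (y i - c j) < M"
    using cov by blast
  from bchoice[OF this] obtain p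
    where p: "\<forall>i\<in>{..card I}. p i \<in> I \<and> norm (y i - c (p i)) < M"
    by blast
  have "p ` {..card I} \<subseteq> I"
    using p by blast
  then have "card (p ` {..card I}) \<le> card I"
    by (rule card_mono[OF I])
  then have "\<not> inj_on p {..card I}"
    by (intro pigeonhole) simp
  then obtain i k where ik: "i \<le> card I" "k \<le> card I" "i < k" "p i = p k"
    unfolding inj_on_def by (metis atMost_iff linorder_neqE_nat)
  have "norm (y k) - norm (y i) \<le> norm ((y k - c (p k)) - (y i - c (p i)))"
    using norm_triangle_ineq2[of "y k" "y i"] ik(4) by simp
  also have "\<dots> \<le> norm (y k - c (p k)) + norm (y i - c (p i))"
    by (rule norm_triangle_ineq4)
  also have "\<dots> < 2 * M"
  proof -
    have "norm (y k - c (p k)) < M" "norm (y i - c (p i)) < M"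
      using p ik(1,2) by auto
    then show ?thesis by linarith
  qed
  finally have "2 * M * (real k - real i) < 2 * M * 1"
    using y ik(1,2) by (simp add: algebra_simps)
  then have "real k - real i < 1"
    using M by (subst (asm) mult_less_cancel_left_pos) auto
  then show False using ik(3) by linarith
qed

context blaschke
begin

text \<open>\<open>F\<close> maps into the unit disc, hence into the collar domain of the next
  Blaschke product, where \<open>blaschke_step\<close> applies with the same \<open>\<rho>\<close>.
  The exponent is \<open>Suc m\<close> as \<open>m = 0\<close> already stands for one step.\<close>

lemma blaschke_iterate:
  assumes a: "\<And>j. j \<in> {1..n} \<Longrightarrow> norm (a j) \<le> r" and B: "B = blaschke_product \<theta> a n"
  shows "\<exists>F \<theta>'. F holomorphic_on collar s B \<rho> \<and> inj_on F (collar s B \<rho>) \<and>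
           F ` collar s B \<rho> \<subseteq> ball 0 1 \<and> F 0 = 0 \<and> (\<forall>j\<in>{1..n}. norm (F (a j)) \<le> r) \<and>
           (\<forall>z\<in>collar s B \<rho>. B z = of_real (\<rho> ^ Suc m) * blaschke_product \<theta>' (F \<circ> a) n (F z))"
    (is "\<exists>F \<theta>'. ?P m F \<theta>'")
proof (induction m)
  case 0
  obtain \<psi> \<theta>' where "\<psi> holomorphic_on collar s B \<rho>" "inj_on \<psi> (collar s B \<rho>)"
    "\<psi> ` collar s B \<rho> \<subseteq> ball 0 1" "\<psi> 0 = 0" "\<And>j. j \<in> {1..n} \<Longrightarrow> norm (\<psi> (a j)) \<le> r"
    "\<And>z. z \<in> collar s B \<rho> \<Longrightarrow> B z = of_real \<rho> * blaschke_product \<theta>' (\<psi> \<circ> a) n (\<psi> z)"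
    using blaschke_step[OF a B] by metis
  then have "?P 0 \<psi> \<theta>'" unfolding power_Suc0_right by blast
  then show ?case by blast
next
  case (Suc m)
  then obtain F \<theta>1 where F: "?P m F \<theta>1" by blast
  define B1 where "B1 = blaschke_product \<theta>1 (F \<circ> a) n"
  have a1: "norm ((F \<circ> a) j) \<le> r" if "j \<in> {1..n}" for j
    using F that by simp
  obtain \<psi> \<theta>' where \<psi>: "\<psi> holomorphic_on collar s B1 \<rho>" "inj_on \<psi> (collar s B1 \<rho>)"
    "\<psi> ` collar s B1 \<rho> \<subseteq> ball 0 1" "\<psi> 0 = 0" "\<And>j. j \<in> {1..n} \<Longrightarrow> norm (\<psi> ((F \<circ> a) j)) \<le> r"
    "\<And>z. z \<in> collar s B1 \<rho> \<Longrightarrow> B1 z = of_real \<rho> * blaschke_product \<theta>' (\<psi> \<circ> (F \<circ> a)) n (\<psi> z)"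
    using blaschke_step[OF a1 B1_def] by metis
  have sub: "F ` collar s B \<rho> \<subseteq> collar s B1 \<rho>"
    using F cball_subset_collar[OF a1 B1_def] ball_subset_cball by (meson order_trans)
  have "?P (Suc m) (\<psi> \<circ> F) \<theta>'"
  proof (intro conjI ballI)
    show "\<psi> \<circ> F holomorphic_on collar s B \<rho>"
      using F \<psi>(1) sub by (auto intro: holomorphic_on_compose_gen)
    show "inj_on (\<psi> \<circ> F) (collar s B \<rho>)"
      using F \<psi>(2) sub by (auto intro: comp_inj_on inj_on_subset)
    show "(\<psi> \<circ> F) ` collar s B \<rho> \<subseteq> ball 0 1"
      using \<psi>(3) sub by force
    show "B z = of_real (\<rho> ^ Suc (Suc m)) * blaschke_product \<theta>' (\<psi> \<circ> F \<circ> a) n ((\<psi> \<circ> F) z)"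
      if z: "z \<in> collar s B \<rho>" for z
    proof -
      have "B z = of_real (\<rho> ^ Suc m) * B1 (F z)"
        unfolding B1_def using F z by blast
      also have "B1 (F z) = of_real \<rho> * blaschke_product \<theta>' (\<psi> \<circ> (F \<circ> a)) n (\<psi> (F z))"
        using \<psi>(6) sub z by blast
      finally show ?thesis by (simp add: o_assoc mult_ac)
    qed
  qed (use F \<psi> in auto)
  then show ?case by blast
qed

text \<open>After rescaling, the denominators of the Blaschke factors tend to 1 while the numerators
  stay bounded, so a polynomial remains in the limit.\<close>

lemma polynomial_model:
  assumes a: "\<And>j. j \<in> {1..n} \<Longrightarrow> norm (a j) \<le> r" and B: "B = blaschke_product \<theta> a n"
  obtains P G where "degree P = n" "G holomorphic_on collar s B \<rho>" "inj_on G (collar s B \<rho>)"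
    "G 0 = 0" "\<And>z. z \<in> collar s B \<rho> \<Longrightarrow> poly P (G z) = B z"
    "\<And>w. poly P w = 0 \<Longrightarrow> w \<in> G ` cball 0 r"
proof -
  let ?U = "collar s B \<rho>"
  have cU: "cball 0 1 \<subseteq> ?U"
    using cball_subset_collar[OF a B] .
  have aU: "a j \<in> ?U" if "j \<in> {1..n}" for j
    using cU zeros_less_1[OF a B that] by auto
  \<comment> \<open>Chosen with \<open>\<delta>^n = 1 / \<rho>\<close>: rescaling each of the
    \<open>n\<close> numerators by \<open>\<delta>^(m+1)\<close> cancels the factor
    \<open>\<rho>^(m+1)\<close>.\<close>
  define \<delta> where "\<delta> = 1 / root n \<rho>"
  have rho1: "\<rho> > 1" using rho_gt_1 .
  have \<delta>: "0 < \<delta>" "\<delta> < 1" "\<delta> ^ n = 1 / \<rho>"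
    using n rho1 by (auto simp: \<delta>_def power_divide)
  obtain F \<theta>' where F: "\<And>m. F m holomorphic_on ?U" "\<And>m. inj_on (F m) ?U" "\<And>m. F m ` ?U \<subseteq> ball 0 1"
    "\<And>m. F m 0 = 0" "\<And>m j. j \<in> {1..n} \<Longrightarrow> norm (F m (a j)) \<le> r"
    "\<And>m z. z \<in> ?U \<Longrightarrow> B z = of_real (\<rho> ^ Suc m) * blaschke_product (\<theta>' m) (F m \<circ> a) n (F m z)"
    using blaschke_iterate[OF a B] by metis
  have F1: "norm (F m z) < 1" if "z \<in> ?U" for m z
    using F(3) that by (force simp: subset_eq)
  define G where "G m z = F m z / of_real (\<delta> ^ Suc m)" for m z
  define D where "D m j z = 1 - cnj (F m (a j)) * F m z" for m j z
  have D: "D m j z \<noteq> 0" "norm (D m j z) \<le> 2" if "z \<in> ?U" "j \<in> {1..n}" for m j z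
  proof -
    have "norm (F m (a j)) * norm (F m z) \<le> r * 1"
      using F(5)[OF that(2)] F1[OF that(1)] r by (intro mult_mono) (auto simp: less_imp_le)
    then show "D m j z \<noteq> 0"
      unfolding D_def using r by (intro blaschke_denominator_nonzero) auto
    have "norm (cnj (F m (a j)) * F m z) \<le> 1"
      using \<open>norm (F m (a j)) * norm (F m z) \<le> r * 1\<close> r by (simp add: norm_mult)
    then show "norm (D m j z) \<le> 2"
      unfolding D_def using norm_triangle_ineq4[of 1 "cnj (F m (a j)) * F m z"] by simp
  qed
  have key: "B z * (\<Prod>j=1..n. D m j z) = cis (\<theta>' m) * (\<Prod>j=1..n. G m z - G m (a j))" if z: "z \<in> ?U" for m z
  proof -
    have "(\<Prod>j=1..n. F m z - F m (a j)) = (\<Prod>j=1..n. of_real (\<delta> ^ Suc m) * (G m z - G m (a j)))"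
      using \<delta> by (intro prod.cong) (auto simp: G_def field_simps)
    also have "\<dots> = of_real ((\<delta> ^ n) ^ Suc m) * (\<Prod>j=1..n. G m z - G m (a j))"
      by (simp add: prod.distrib power_mult[symmetric] mult.commute power_mult_distrib flip: of_real_power)
    finally have 1: "(\<Prod>j=1..n. F m z - F m (a j)) = (\<Prod>j=1..n. G m z - G m (a j)) / of_real (\<rho> ^ Suc m)"
      unfolding \<delta>(3) by (simp add: power_divide)
    have "B z = of_real (\<rho> ^ Suc m) * (cis (\<theta>' m) * ((\<Prod>j=1..n. F m z - F m (a j)) / (\<Prod>j=1..n. D m j z)))"
      using F(6)[OF z, of m] unfolding blaschke_product_eq blaschke_factor_def D_def prod_dividef by simp
    also have "\<dots> = cis (\<theta>' m) * (\<Prod>j=1..n. G m z - G m (a j)) / (\<Prod>j=1..n. D m j z)"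
      unfolding 1 using rho1 by simp
    finally show ?thesis
      using D(1)[OF z] by simp
  qed
  \<comment> \<open>Otherwise every numerator is at least \<open>2 * \<rho>\<close>, but by
    \<open>key\<close> their product is below \<open>\<rho> * 2^n\<close>, since each denominator is
    at most 2.\<close>
  have cov: "\<exists>j\<in>{1..n}. norm (G m z - G m (a j)) < 2 * \<rho>" if z: "z \<in> ?U" for m z
  proof (rule ccontr)
    assume "\<not> ?thesis"
    then have "2 * \<rho> \<le> norm (G m z - G m (a j))" if "j \<in> {1..n}" for j
      using that by (meson not_less)
    then have "(\<Prod>j=1..n. 2 * \<rho>) \<le> (\<Prod>j=1..n. norm (G m z - G m (a j)))"
      using rho1 by (intro prod_mono) auto
    also have "\<dots> = norm (B z) * (\<Prod>j=1..n. norm (D m j z))"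
      using arg_cong[OF key[OF z, of m], of norm] by (simp add: norm_mult prod_norm)
    also have "\<dots> \<le> norm (B z) * (\<Prod>j=1..n. 2)"
      using D(2)[OF z] by (intro mult_left_mono prod_mono) auto
    also have "\<dots> < \<rho> * 2 ^ n"
      using z by (simp add: collar_def)
    also have "\<dots> \<le> \<rho> ^ n * 2 ^ n"
      using rho1 n self_le_power[of \<rho> n] by simp
    finally show False by (simp add: power_mult_distrib)
  qed
  \<comment> \<open>The image of the domain is connected, contains 0 and is covered by
    \<open>n\<close> balls of radius \<open>2 * \<rho>\<close>; this gives a bound independent of
    \<open>m\<close>.\<close>
  have bdd: "norm (G m z) \<le> 2 * (2 * \<rho>) * real n" if z: "z \<in> ?U" for m z
  proof -
    have "continuous_on ?U (G m)"
      unfolding G_def using F(1) \<delta> by (intro continuous_intros holomorphic_on_imp_continuous_on) auto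
    then have "connected (G m ` ?U)"
      using connected_collar[OF a B] by (rule connected_continuous_image)
    moreover have "0 \<in> G m ` ?U"
      using cU F(4) by (intro image_eqI[of _ _ 0]) (auto simp: G_def)
    ultimately have "norm (G m z) < 2 * (2 * \<rho>) * real (card {1..n})"
      using rho1 cov z
      by (intro connected_covered_by_balls_bound[of "G m ` ?U" _ _ "\<lambda>j. G m (a j)"]) auto
    then show ?thesis by simp
  qed
  \<comment> \<open>A first subsequence makes the unimodular constants converge; the one from the
    theorem of Montel refines it.\<close>
  obtain c r1 where r1: "norm c = 1" "strict_mono (r1 :: nat \<Rightarrow> nat)" "((\<lambda>m. cis (\<theta>' m)) \<circ> r1) \<longlonglongrightarrow> c"
  proof -
    have "\<forall>m. cis (\<theta>' m) \<in> sphere 0 1" by simp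
    then show ?thesis
      using compact_sphere[of 0 1] that unfolding compact_def by (metis mem_sphere_0)
  qed
  have G_hol: "G m holomorphic_on ?U" for m
    unfolding G_def using F(1) \<delta> by (intro holomorphic_intros) auto
  have "\<exists>g r2. g holomorphic_on ?U \<and> strict_mono (r2 :: nat \<Rightarrow> nat) \<and>
      (\<forall>x\<in>?U. (\<lambda>m. G (r1 (r2 m)) x) \<longlonglongrightarrow> g x) \<and>
      (\<forall>K. compact K \<longrightarrow> K \<subseteq> ?U \<longrightarrow> uniform_limit K (\<lambda>m. G (r1 (r2 m))) g sequentially)"
  proof (rule Montel[of ?U "{h. h holomorphic_on ?U \<and> (\<forall>z\<in>?U. norm (h z) \<le> 2 * (2 * \<rho>) * real n)}" "G \<circ> r1"])
    show "open ?U" using open_collar[OF a B] .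
    show "range (G \<circ> r1) \<subseteq> {h. h holomorphic_on ?U \<and> (\<forall>z\<in>?U. norm (h z) \<le> 2 * (2 * \<rho>) * real n)}"
      using G_hol bdd by auto
  qed (auto simp: o_def)
  then obtain g r2 where g: "g holomorphic_on ?U" and r2: "strict_mono (r2 :: nat \<Rightarrow> nat)"
    and lim: "\<And>x. x \<in> ?U \<Longrightarrow> (\<lambda>m. G (r1 (r2 m)) x) \<longlonglongrightarrow> g x"
    and unif: "\<And>K. compact K \<Longrightarrow> K \<subseteq> ?U \<Longrightarrow> uniform_limit K (\<lambda>m. G (r1 (r2 m))) g sequentially"
    by metis
  define q where "q m = r1 (r2 m)" for m
  have q: "strict_mono q"
    using r1(2) r2 by (auto simp: q_def strict_mono_def)
  have c: "(\<lambda>m. cis (\<theta>' (q m))) \<longlonglongrightarrow> c"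
    using LIMSEQ_subseq_LIMSEQ[OF r1(3) r2] by (simp add: o_def q_def)
  \<comment> \<open>\<open>F m z\<close> is \<open>\<delta>^(m+1)\<close> times the bounded
    \<open>G m z\<close>, so it tends to 0 and the denominators to 1.\<close>
  have Dlim: "(\<lambda>m. D (q m) j z) \<longlonglongrightarrow> 1" if z: "z \<in> ?U" and j: "j \<in> {1..n}" for j z
  proof -
    have "(\<lambda>m. \<delta> ^ Suc m * (2 * (2 * \<rho>) * real n)) \<longlonglongrightarrow> 0 * (2 * (2 * \<rho>) * real n)"
      using \<delta> by (intro tendsto_intros LIMSEQ_Suc LIMSEQ_realpow_zero) auto
    then have lim0: "(\<lambda>m. \<delta> ^ Suc m * (2 * (2 * \<rho>) * real n)) \<longlonglongrightarrow> 0"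
      by (simp only: mult_zero_left)
    have le: "norm (cnj (F m (a j)) * F m z) \<le> \<delta> ^ Suc m * (2 * (2 * \<rho>) * real n)" for m
    proof -
      have "norm (cnj (F m (a j)) * F m z) \<le> 1 * norm (F m z)"
        unfolding norm_mult using F(5)[OF j, of m] r by (intro mult_right_mono) auto
      also have "1 * norm (F m z) = \<delta> ^ Suc m * norm (G m z)"
        using \<delta> by (simp add: G_def norm_divide norm_mult norm_power)
      also have "\<dots> \<le> \<delta> ^ Suc m * (2 * (2 * \<rho>) * real n)"
        using bdd[OF z, of m] \<delta>(1) by (intro mult_left_mono) auto
      finally show ?thesis .
    qed
    have "(\<lambda>m. cnj (F m (a j)) * F m z) \<longlonglongrightarrow> 0"
      by (rule Lim_null_comparison[OF always_eventually lim0]) (use le in blast)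
    then have "(\<lambda>m. cnj (F (q m) (a j)) * F (q m) z) \<longlonglongrightarrow> 0"
      using LIMSEQ_subseq_LIMSEQ[OF _ q] by (simp add: o_def)
    from tendsto_diff[OF tendsto_const[of 1] this] show ?thesis
      unfolding D_def by simp
  qed
  define P where "P = smult c (\<Prod>j=1..n. [:- g (a j), 1:])"
  have Pg: "poly P (g z) = B z" if z: "z \<in> ?U" for z
  proof -
    have "(\<lambda>m. B z * (\<Prod>j=1..n. D (q m) j z)) \<longlonglongrightarrow> B z * (\<Prod>j=1..n. 1)"
      using Dlim[OF z] by (intro tendsto_intros) auto
    moreover have "(\<lambda>m. cis (\<theta>' (q m)) * (\<Prod>j=1..n. G (q m) z - G (q m) (a j)))
        \<longlonglongrightarrow> c * (\<Prod>j=1..n. g z - g (a j))"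
      unfolding q_def by (intro tendsto_intros lim c[unfolded q_def] z aU) auto
    ultimately have "B z = c * (\<Prod>j=1..n. g z - g (a j))"
      unfolding key[OF z] using LIMSEQ_unique by fastforce
    then show ?thesis
      by (simp add: P_def poly_prod)
  qed
  have nonconst: "\<not> g constant_on ?U"
  proof
    assume "g constant_on ?U"
    moreover have "a 1 \<in> ?U" "1 \<in> ?U"
      using n aU cU by auto
    ultimately have "g (a 1) = g 1"
      unfolding constant_on_def by metis
    then have "B (a 1) = B 1"
      using Pg \<open>a 1 \<in> ?U\<close> \<open>1 \<in> ?U\<close> by metis
    moreover have "B (a 1) = 0"
      unfolding B blaschke_product_def using n by force
    ultimately show False
      using norm_blaschke_eq_1[OF a B, of 1] by simp
  qed
  have inj: "inj_on g ?U"
  proof (rule Hurwitz_injective[of ?U "\<lambda>m. G (r1 (r2 m))"])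
    show "inj_on (G (r1 (r2 m))) ?U" for m
      using F(2)[of "r1 (r2 m)"] \<delta> by (auto simp: G_def inj_on_def)
  qed (use open_collar[OF a B] connected_collar[OF a B] G_hol g unif nonconst in auto)
  have deg: "degree P = n"
    using r1(1) by (auto simp: P_def degree_prod_eq_sum_degree)
  have g0: "g 0 = 0"
  proof -
    have "0 \<in> ?U" using cU by auto
    from lim[OF this] show ?thesis by (simp add: G_def F(4) LIMSEQ_const_iff)
  qed
  have zr: "w \<in> g ` cball 0 r" if "poly P w = 0" for w
    using that r1(1) a by (auto simp: P_def poly_prod)
  show thesis
    by (rule that[OF deg g inj g0 Pg zr])
qed

end

section \<open>The lemniscate\<close>

text \<open>
  If \<open>b\<close> maps the origin to \<open>c\<close>, then by the Schwarz lemma the composition of \<open>b\<close> with the disc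
  automorphism taking \<open>c\<close> to \<open>0\<close> approaches the circle at most as fast as the identity does.
\<close>

lemma deriv_nonzero_on_circle:
  assumes b: "b holomorphic_on U" "open U" "cball 0 1 \<subseteq> U"
    and less: "\<And>z. norm z < 1 \<Longrightarrow> norm (b z) < 1" and z0: "norm z0 = 1" "norm (b z0) = 1"
  shows "deriv b z0 \<noteq> 0"
proof
  assume d0: "deriv b z0 = 0"
  define c where "c = b 0"
  define f where "f z = blaschke_factor c (b z)" for z
  have c1: "norm c < 1" using less[of 0] by (simp add: c_def)
  have nz: "1 - cnj c * b z \<noteq> 0" if "norm (b z) \<le> 1" for z
  proof (rule blaschke_denominator_nonzero)
    have "norm c * norm (b z) \<le> norm c * 1"
      using that by (intro mult_left_mono) auto
    then show "norm c * norm (b z) < 1" using c1 by simp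
  qed
  have bz: "norm (b z) \<le> 1" if "z \<in> ball 0 1" for z
    using less that by (simp add: less_imp_le)
  have "b holomorphic_on ball 0 1"
    using b(1,3) ball_subset_cball by (meson holomorphic_on_subset order_trans)
  then have f: "f holomorphic_on ball 0 1"
    unfolding f_def blaschke_factor_def using nz bz by (intro holomorphic_intros) auto
  have fz: "norm (f z) \<le> norm z" if "norm z < 1" for z
    by (rule Schwarz_Lemma(1)[OF f _ _ that])
      (auto simp: f_def blaschke_factor_less_1 c1 less, simp add: blaschke_factor_def c_def)
  have "z0 \<in> U"
    using b(3) z0(1) by auto
  then have "(b has_field_derivative 0) (at z0)"
    using holomorphic_derivI[OF b(1,2)] d0 by metis
  then have "(f has_field_derivative 0) (at z0)"
    unfolding f_def blaschke_factor_def
    using nz[of z0] z0(2) by (auto intro!: derivative_eq_intros)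
  then have lim: "((\<lambda>z. (f z - f z0) / (z - z0)) \<longlongrightarrow> 0) (at z0)"
    by (simp add: has_field_derivative_iff)
  \<comment> \<open>Along the radius, the Schwarz lemma gives \<open>|f| \<le> t\<close> at
    \<open>t z0\<close>, while \<open>|f| = 1\<close> at \<open>z0\<close>. The difference quotient
    thus has modulus at least 1 and cannot tend to 0.\<close>
  have path: "filterlim (\<lambda>t. of_real t * z0) (at z0) (at_left 1)"
  proof -
    have "((\<lambda>t. of_real t * z0) \<longlongrightarrow> of_real 1 * z0) (at_left 1)"
      by (intro tendsto_intros)
    moreover have "eventually (\<lambda>t. of_real t * z0 \<noteq> z0) (at_left 1)"
      using eventually_at_left_field[of _ "1::real"] z0(1) by (force intro: exI[of _ 0])
    ultimately show ?thesis
      by (simp add: filterlim_at)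
  qed
  have "((\<lambda>t. norm ((f (of_real t * z0) - f z0) / (of_real t * z0 - z0))) \<longlongrightarrow> 0) (at_left (1::real))"
    using filterlim_compose[OF lim path] by (simp add: tendsto_norm_zero)
  then have "eventually (\<lambda>t. norm ((f (of_real t * z0) - f z0) / (of_real t * z0 - z0)) < 1) (at_left (1::real))"
    by (rule order_tendstoD) simp
  then obtain e where e: "e < 1" "\<And>t. e < t \<Longrightarrow> t < 1 \<Longrightarrow>
      norm ((f (of_real t * z0) - f z0) / (of_real t * z0 - z0)) < 1"
    unfolding eventually_at_left_field by blast
  obtain t :: real where t: "max e 0 < t" "t < 1"
    using dense[of "max e 0" 1] e(1) by auto
  have "of_real t * z0 - z0 = of_real (t - 1) * z0"
    by (simp add: algebra_simps)
  then have 1: "norm (of_real t * z0 - z0) = 1 - t"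
    using t z0 by (simp add: norm_mult del: of_real_diff)
  have "norm (f z0) = 1"
    unfolding f_def by (rule blaschke_factor_eq_1[OF c1 z0(2)])
  moreover have "norm (f (of_real t * z0)) \<le> t"
    using fz[of "of_real t * z0"] t z0 by (simp add: norm_mult)
  ultimately have "1 - t \<le> norm (f (of_real t * z0) - f z0)"
    using norm_triangle_ineq3[of "f (of_real t * z0)" "f z0"] by linarith
  moreover have "norm (f (of_real t * z0) - f z0) < 1 - t"
    using e(2)[of t] t 1 by (simp add: norm_divide divide_simps)
  ultimately show False by linarith
qed

text \<open>Of the relation \<open>poly P (G z) = B z\<close>, only the moduli on the closed disc
  enter here, together with the position of the zeros of \<open>P\<close>. The domain
  \<open>U\<close> of univalence reaches beyond the circle.\<close>

locale lemniscate =
  fixes n :: nat and P :: "complex poly" and U :: "complex set" and G :: "complex \<Rightarrow> complex" and r :: real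
  assumes n: "n \<ge> 1" and deg: "degree P = n" and U: "open U" "cball 0 1 \<subseteq> U"
    and G: "G holomorphic_on U" "inj_on G U" "G 0 = 0" and r: "0 < r" "r < 1"
    and zeros: "\<And>w. poly P w = 0 \<Longrightarrow> w \<in> G ` cball 0 r"
    and PG_less: "\<And>z. norm z < 1 \<Longrightarrow> norm (poly P (G z)) < 1"
    and PG_eq: "\<And>z. norm z = 1 \<Longrightarrow> norm (poly P (G z)) = 1"
begin

lemma continuous_G: "continuous_on U G"
  using G(1) by (rule holomorphic_on_imp_continuous_on)

lemma compact_K: "t \<le> 1 \<Longrightarrow> compact (G ` cball 0 t)"
  using continuous_G U(2) by (intro compact_continuous_image) (auto intro!: continuous_on_subset[OF _ order_trans[OF _ U(2)]])

lemma open_G_ball: "t \<le> 1 \<Longrightarrow> open (G ` ball 0 t)"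
  using U(2) by (intro open_mapping_thm3 holomorphic_on_subset[OF G(1)] inj_on_subset[OF G(2)]) 
    (auto intro!: order_trans[OF _ U(2)])

lemma G_in_K_iff: "z \<in> U \<Longrightarrow> t \<le> 1 \<Longrightarrow> G z \<in> G ` cball 0 t \<longleftrightarrow> norm z \<le> t"
proof -
  assume *: "z \<in> U" "t \<le> 1"
  then have "cball 0 t \<subseteq> U"
    using U(2) by (auto intro!: order_trans[OF _ U(2)])
  then show ?thesis
    using * inj_on_image_mem_iff[OF G(2)] by auto
qed

lemma connected_complement_K:
  assumes "t \<le> 1" shows "connected (- G ` cball 0 t)"
proof (rule connected_complement_homeomorphic_convex_compact)
  have sub: "cball 0 t \<subseteq> U"
    using assms by (auto intro!: order_trans[OF _ U(2)])
  show "G ` cball 0 t homeomorphic (cball 0 t :: complex set)"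
    by (metis compact_cball continuous_G continuous_on_subset G(2) homeomorphic_compact
        homeomorphic_sym inj_on_subset sub)
qed auto

lemma P_nonconstant: "\<not> poly P constant_on S" if "open S" "S \<noteq> {}"
proof
  assume "poly P constant_on S"
  then obtain c where c: "\<And>x. x \<in> S \<Longrightarrow> poly (P - [:c:]) x = 0"
    unfolding constant_on_def by auto
  have "infinite S"
    using that finite_imp_not_open by blast
  then have "P - [:c:] = 0"
    using poly_roots_finite[of "P - [:c:]"] c by (metis (mono_tags) finite_subset mem_Collect_eq subsetI)
  then have "degree P = 0" by simp
  then show False using n deg by simp
qed

lemma poly_holomorphic: "poly P holomorphic_on S"
  by (intro holomorphic_intros)

lemma poly_continuous: "continuous_on S (\<lambda>w. norm (poly P w))"
  by (intro continuous_intros)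

section \<open>Level sets of the polynomial and the two sides of the curve\<close>

lemma bounded_sublevel: "bounded {w. norm (poly P w) \<le> c}"
proof -
  have "filterlim (poly P) at_infinity at_infinity"
    using n deg by (intro filterlim_poly_at_infinity) auto
  then have "eventually (\<lambda>w. c < norm (poly P w)) at_infinity"
    unfolding filterlim_at_infinity_conv_norm_at_top filterlim_at_top_dense by blast
  then obtain b where "\<And>w. b \<le> norm w \<Longrightarrow> c < norm (poly P w)"
    unfolding eventually_at_infinity by auto
  then have "{w. norm (poly P w) \<le> c} \<subseteq> cball 0 b"
    by (metis (mono_tags, lifting) linorder_linear mem_Collect_eq mem_cball_0 not_less subsetI)
  then show ?thesis
    using bounded_cball bounded_subset by blast
qed

lemma open_sublevel: "open {w. norm (poly P w) < 1}" and open_suplevel: "open {w. norm (poly P w) > 1}"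
  by (intro open_Collect_less poly_continuous continuous_on_const)+

text \<open>A point of the sublevel set outside the image would lie in a bounded open set
  \<open>V\<close> whose closure contains no zeros of \<open>P\<close> and on whose frontier
  \<open>|P| = 1\<close>. The maximum principle for \<open>1 / P\<close> excludes this.\<close>

lemma sublevel_eq: "{w. norm (poly P w) < 1} = G ` ball 0 1"
proof
  show "G ` ball 0 1 \<subseteq> {w. norm (poly P w) < 1}"
    using PG_less by auto
next
  define V where "V = {w. norm (poly P w) < 1} - G ` cball 0 1"
  have "open V"
    unfolding V_def using compact_K[of 1] open_sublevel by (intro open_Diff compact_imp_closed) auto
  have clV: "closure V \<subseteq> - G ` ball 0 1"
    using open_G_ball[of 1] by (intro closure_minimal) (auto simp: V_def)
  have nz: "poly P w \<noteq> 0" if "w \<in> closure V" for w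
  proof
    assume "poly P w = 0"
    then have "w \<in> G ` ball 0 1"
      using zeros[of w] r by auto
    then show False using clV that by blast
  qed
  have "V = {}"
  proof (rule ccontr)
    assume "V \<noteq> {}"
    then obtain w where w: "w \<in> V" by blast
    have "norm (1 / poly P w) \<le> 1"
    proof (rule maximum_modulus_frontier[of "\<lambda>w. 1 / poly P w" V])
      show "(\<lambda>w. 1 / poly P w) holomorphic_on interior V"
        using nz interior_subset closure_subset by (intro holomorphic_intros) blast
      show "continuous_on (closure V) (\<lambda>w. 1 / poly P w)"
        using nz by (intro continuous_intros) auto
      show "bounded V"
        by (rule bounded_subset[OF bounded_sublevel[of 1]]) (auto simp: V_def)
      show "w \<in> V" by (rule w)
      fix x assume "x \<in> frontier V"
      then have x: "x \<in> closure V" "x \<notin> V"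
        using \<open>open V\<close> by (auto simp: frontier_def interior_open)
      have "norm (poly P x) = 1"
      proof (rule ccontr)
        have "closed {w. norm (poly P w) \<le> 1}"
          by (intro closed_Collect_le poly_continuous continuous_on_const)
        then have "closure V \<subseteq> {w. norm (poly P w) \<le> 1}"
          by (intro closure_minimal) (auto simp: V_def)
        moreover assume "norm (poly P x) \<noteq> 1"
        ultimately have "norm (poly P x) < 1"
          using x by force
        then have "x \<in> G ` ball 0 1"
          using x(2) PG_eq unfolding V_def by (force simp: le_less)
        then show False using clV x(1) by blast
      qed
      then show "norm (1 / poly P x) \<le> 1" by (simp add: norm_divide)
    qed
    then show False
      using w nz[of w] closure_subset[of V] by (auto simp: V_def norm_divide divide_simps)
  qed
  then show "{w. norm (poly P w) < 1} \<subseteq> G ` ball 0 1"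
    using PG_eq unfolding V_def by (force simp: le_less)
qed

text \<open>\<open>P\<close> is an open map, so in every neighbourhood of \<open>w\<close> it takes
  the values \<open>(1 + s) * poly P w\<close> for small real \<open>s\<close> of either
  sign.\<close>

lemma level_in_closure:
  assumes "norm (poly P w) = 1"
  shows "w \<in> closure {w. norm (poly P w) < 1}" "w \<in> closure {w. norm (poly P w) > 1}"
proof -
  have *: "\<exists>x\<in>ball w e. norm (poly P x) < 1" "\<exists>x\<in>ball w e. norm (poly P x) > 1" if "e > 0" for e
  proof -
    have "open (poly P ` ball w e)"
      using P_nonconstant[of UNIV] by (intro open_mapping_thm[of "poly P" UNIV]) (auto simp: poly_holomorphic)
    moreover have "poly P w \<in> poly P ` ball w e"
      using that by simp
    ultimately obtain d where d: "d > 0" "ball (poly P w) d \<subseteq> poly P ` ball w e"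
      by (meson openE)
    have "\<exists>x\<in>ball w e. norm (poly P x) = \<bar>1 + s\<bar>" if "\<bar>s\<bar> < d" for s :: real
    proof -
      have "dist (poly P w) (of_real (1 + s) * poly P w) = \<bar>s\<bar> * norm (poly P w)"
        by (simp add: dist_norm algebra_simps norm_mult)
      then have "of_real (1 + s) * poly P w \<in> poly P ` ball w e"
        using that assms d(2) by (intro subsetD[OF d(2)]) simp
      then obtain x where "x \<in> ball w e" "poly P x = of_real (1 + s) * poly P w"
        by (metis imageE)
      then show ?thesis
        using assms by (intro bexI[of _ x]) (simp_all add: norm_mult del: of_real_add)
    qed
    from this[of "- (min d 1 / 2)"] this[of "min d 1 / 2"] 
    show "\<exists>x\<in>ball w e. norm (poly P x) < 1" "\<exists>x\<in>ball w e. norm (poly P x) > 1"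
      using d(1) by force+
  qed
  show "w \<in> closure {w. norm (poly P w) < 1}" "w \<in> closure {w. norm (poly P w) > 1}"
    unfolding closure_approachable using * by (metis dist_commute mem_Collect_eq mem_ball)+
qed

lemma sublevel_closed_eq: "{w. norm (poly P w) \<le> 1} = G ` cball 0 1"
proof
  show "G ` cball 0 1 \<subseteq> {w. norm (poly P w) \<le> 1}"
    using PG_less PG_eq by (force simp: le_less)
  have "closure (G ` ball 0 1) \<subseteq> G ` cball 0 1"
    using compact_K[of 1] by (intro closure_minimal compact_imp_closed) auto
  moreover have "{w. norm (poly P w) \<le> 1} \<subseteq> closure (G ` ball 0 1)"
    unfolding sublevel_eq[symmetric]
    using level_in_closure(1) closure_subset[of "{w. norm (poly P w) < 1}"] by (auto simp: le_less)
  ultimately show "{w. norm (poly P w) \<le> 1} \<subseteq> G ` cball 0 1"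
    by (rule order_trans[rotated])
qed

definition \<Gamma> :: "complex set" where "\<Gamma> = {w. norm (poly P w) = 1}"

lemma \<Gamma>_eq: "\<Gamma> = G ` sphere 0 1"
proof
  show "G ` sphere 0 1 \<subseteq> \<Gamma>" using PG_eq by (auto simp: \<Gamma>_def)
  show "\<Gamma> \<subseteq> G ` sphere 0 1"
  proof
    fix w assume w: "w \<in> \<Gamma>"
    then obtain z where z: "w = G z" "norm z \<le> 1"
    proof -
      have "w \<in> G ` cball 0 1"
        using w unfolding sublevel_closed_eq[symmetric] by (simp add: \<Gamma>_def)
      then show ?thesis using that by auto
    qed
    then have "norm z = 1"
      using w PG_less[of z] by (force simp: \<Gamma>_def le_less)
    then show "w \<in> G ` sphere 0 1" using z by auto
  qed
qed

lemma suplevel_eq: "{w. norm (poly P w) > 1} = - G ` cball 0 1"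
  using sublevel_closed_eq by (auto simp: set_eq_iff not_le[symmetric])

text \<open>On a component of the complement of the curve \<open>|P|\<close> stays on one side of 1.
  The sublevel set is bounded, while the superlevel set is connected and unbounded, being the
  complement of a compact disc image.\<close>

lemma inside_\<Gamma>: "inside \<Gamma> = {w. norm (poly P w) < 1}"
proof
  show "{w. norm (poly P w) < 1} \<subseteq> inside \<Gamma>"
  proof
    fix w assume w: "w \<in> {w. norm (poly P w) < 1}"
    let ?C = "connected_component_set (- \<Gamma>) w"
    have "connected ((\<lambda>w. norm (poly P w)) ` ?C)"
      by (intro connected_continuous_image poly_continuous connected_connected_component)
    moreover have "norm (poly P w) \<in> (\<lambda>w. norm (poly P w)) ` ?C"
      using w by (auto simp: \<Gamma>_def connected_component_refl)
    moreover have "1 \<notin> (\<lambda>w. norm (poly P w)) ` ?C"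
      using connected_component_subset[of "- \<Gamma>" w] by (auto simp: \<Gamma>_def)
    ultimately have "norm (poly P x) < 1" if "x \<in> ?C" for x
      using w connectedD_interval[of "(\<lambda>w. norm (poly P w)) ` ?C" "norm (poly P w)" "norm (poly P x)" 1] that
      by force
    then have "?C \<subseteq> {w. norm (poly P w) \<le> 1}" by (auto simp: less_imp_le)
    then have "bounded ?C" using bounded_sublevel bounded_subset by blast
    then show "w \<in> inside \<Gamma>"
      using w by (auto simp: inside_def \<Gamma>_def)
  qed
next
  show "inside \<Gamma> \<subseteq> {w. norm (poly P w) < 1}"
  proof (rule ccontr)
    assume "\<not> inside \<Gamma> \<subseteq> {w. norm (poly P w) < 1}"
    then obtain w where w: "w \<in> inside \<Gamma>" "norm (poly P w) \<ge> 1"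
      by (metis mem_Collect_eq not_less subsetI)
    moreover have "w \<notin> \<Gamma>"
      using w(1) inside_no_overlap[of \<Gamma>] by blast
    ultimately have "norm (poly P w) > 1"
      by (simp add: \<Gamma>_def)
    have "{w. norm (poly P w) > 1} \<subseteq> connected_component_set (- \<Gamma>) w"
      using \<open>norm (poly P w) > 1\<close> connected_complement_K[of 1] unfolding suplevel_eq[symmetric]
      by (intro connected_component_maximal) (auto simp: \<Gamma>_def)
    then have "bounded {w. norm (poly P w) > 1}"
      using w(1) bounded_subset by (auto simp: inside_def)
    then have "bounded (- G ` cball 0 1)" by (simp add: suplevel_eq)
    then show False
      using cobounded_imp_unbounded[of "G ` cball 0 1"] compact_K[of 1] compact_imp_bounded
      by (auto dest: cobounded_imp_unbounded)
  qed
qed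

lemma closure_inside_\<Gamma>: "closure (inside \<Gamma>) = {w. norm (poly P w) \<le> 1}"
proof
  have "closed {w. norm (poly P w) \<le> 1}"
    by (intro closed_Collect_le poly_continuous continuous_on_const)
  then show "closure (inside \<Gamma>) \<subseteq> {w. norm (poly P w) \<le> 1}"
    unfolding inside_\<Gamma> by (intro closure_minimal) auto
  show "{w. norm (poly P w) \<le> 1} \<subseteq> closure (inside \<Gamma>)"
    unfolding inside_\<Gamma> using level_in_closure(1) closure_subset[of "{w. norm (poly P w) < 1}"]
    by (auto simp: le_less)
qed

lemma exterior_\<Gamma>: "- closure (inside \<Gamma>) = {w. norm (poly P w) > 1}"
  unfolding closure_inside_\<Gamma> by auto

lemma closure_exterior_\<Gamma>: "closure (- closure (inside \<Gamma>)) = {w. norm (poly P w) \<ge> 1}"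
proof
  have "closed {w. norm (poly P w) \<ge> 1}"
    by (intro closed_Collect_le poly_continuous continuous_on_const)
  then show "closure (- closure (inside \<Gamma>)) \<subseteq> {w. norm (poly P w) \<ge> 1}"
    unfolding exterior_\<Gamma> by (intro closure_minimal) auto
  show "{w. norm (poly P w) \<ge> 1} \<subseteq> closure (- closure (inside \<Gamma>))"
    unfolding exterior_\<Gamma> using level_in_closure(2) closure_subset[of "{w. norm (poly P w) > 1}"]
    by (auto simp: le_less)
qed

section \<open>Smoothness of the lemniscate\<close>

lemma deriv_P_nonzero:
  assumes "w \<in> \<Gamma>" shows "poly (pderiv P) w \<noteq> 0"
proof -
  obtain z where z: "w = G z" "norm z = 1"
    using assms \<Gamma>_eq by auto
  have "deriv (\<lambda>z. poly P (G z)) z \<noteq> 0"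
    using U z(2) PG_less PG_eq
    by (intro deriv_nonzero_on_circle[of _ U] holomorphic_on_compose[OF G(1) poly_holomorphic, unfolded o_def]) auto
  moreover have "((\<lambda>z. poly P (G z)) has_field_derivative poly (pderiv P) (G z) * deriv G z) (at z)"
    using z(2) U by (intro DERIV_chain2[OF poly_DERIV] holomorphic_derivI[OF G(1) U(1)]) auto
  ultimately show ?thesis
    using z(1) DERIV_imp_deriv by fastforce
qed

lemma proper_lemniscate_\<Gamma>: "proper_lemniscate n \<Gamma>"
  unfolding proper_lemniscate_def
proof (intro exI[of _ P] conjI ballI)
  have "connected (G ` ball 0 1)"
    using U(2) by (intro connected_continuous_image continuous_on_subset[OF continuous_G]) auto
  then show "connected {z. norm (poly P z) < 1}" by (simp add: sublevel_eq)
qed (use deg deriv_P_nonzero \<Gamma>_def in auto)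

text \<open>\<open>G\<close> is univalent in a neighbourhood of the circle, so its derivative has no
  zero there, and the loop is differentiable from both sides at its end points.\<close>

lemma C1_jordan_curve_\<Gamma>: "C1_jordan_curve \<Gamma>"
  unfolding C1_jordan_curve_def
proof (intro exI[of _ "G \<circ> circlepath 0 1"] conjI ballI)
  let ?c = "circlepath 0 1"
  let ?d = "\<lambda>t. 2 * pi * \<i> * exp (2 * of_real pi * \<i> * of_real t)"
  have c: "?c t \<in> U" "norm (?c t) = 1" for t
    using U(2) by (auto simp: circlepath)
  have injs: "inj_on G (path_image ?c)"
    using c by (intro inj_on_subset[OF G(2)]) (auto simp: path_image_def)
  show "simple_path (G \<circ> ?c)"
  proof (rule simple_path_continuous_image)
    show "continuous_on (path_image ?c) G"
      using c by (intro continuous_on_subset[OF continuous_G]) (auto simp: path_image_def)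
  qed (use injs simple_path_circlepath in auto)
  show "pathfinish (G \<circ> ?c) = pathstart (G \<circ> ?c)"
    by (simp add: pathfinish_compose pathstart_compose)
  show "path_image (G \<circ> ?c) = \<Gamma>"
    by (simp add: path_image_compose \<Gamma>_eq)
  have dc: "(?c has_vector_derivative ?d t) (at t)" for t
    using has_vector_derivative_circlepath[of 0 1 t UNIV] by simp
  have d: "((G \<circ> ?c) has_vector_derivative ?d t * deriv G (?c t)) (at t)" for t
    by (rule field_vector_diff_chain_at[OF dc]) (use holomorphic_derivI[OF G(1) U(1) c(1)] in auto)
  have "continuous_on {0..1} (\<lambda>t. ?d t * deriv G (?c t))"
    using c by (intro continuous_intros continuous_on_compose2[OF holomorphic_on_imp_continuous_on[OF holomorphic_deriv[OF G(1) U(1)]]])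
      (auto simp: circlepath intro!: continuous_intros)
  then show "(G \<circ> ?c) C1_differentiable_on {0..1}"
    unfolding C1_differentiable_on_def using d
    by (intro exI[of _ "\<lambda>t. ?d t * deriv G (?c t)"]) auto
  have v: "vector_derivative (G \<circ> ?c) (at t) = ?d t * deriv G (?c t)" for t
    using d by (rule vector_derivative_at)
  show "vector_derivative (G \<circ> ?c) (at t) \<noteq> 0" for t
    unfolding v using holomorphic_injective_imp_regular[OF G(1) U(1) G(2) c(1)] by simp
  show "vector_derivative (G \<circ> ?c) (at 0) = vector_derivative (G \<circ> ?c) (at 1)"
    unfolding v by (simp add: circlepath exp_eq_1)
qed

end

section \<open>The exterior map\<close>

context lemniscate
begin

text \<open>
  The image under \<open>w \<mapsto> 1 / w\<close> of the complement of \<open>G ` cball 0 t\<close> in the Riemann sphere, which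
  moves the point at infinity to the origin.
\<close>

definition V :: "real \<Rightarrow> complex set" where
  "V t = {v. v = 0 \<or> 1 / v \<notin> G ` cball 0 t}"

lemma ball_subset_V:
  assumes "t \<le> 1"
  obtains d where "d > 0" "ball 0 d \<subseteq> V t"
proof -
  obtain M where M: "M > 0" "\<And>w. w \<in> G ` cball 0 t \<Longrightarrow> norm w \<le> M"
    using compact_imp_bounded[OF compact_K[OF assms]] unfolding bounded_pos by blast
  have "ball 0 (1 / M) \<subseteq> V t"
  proof
    fix v :: complex assume v: "v \<in> ball 0 (1 / M)"
    show "v \<in> V t"
    proof (cases "v = 0")
      case False
      then have "norm (1 / v) > M"
        using v M(1) by (simp add: norm_divide field_simps)
      then have "1 / v \<notin> G ` cball 0 t"
        using M(2) not_le by blast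
      then show ?thesis by (simp add: V_def)
    qed (simp add: V_def)
  qed
  then show ?thesis
    using M(1) by (intro that[of "1 / M"]) auto
qed

lemma V_minus_0:
  assumes "0 \<le> t" shows "V t - {0} = (\<lambda>w. 1 / w) ` (- G ` cball 0 t)"
proof
  show "V t - {0} \<subseteq> (\<lambda>w. 1 / w) ` (- G ` cball 0 t)"
  proof
    fix v assume "v \<in> V t - {0}"
    then show "v \<in> (\<lambda>w. 1 / w) ` (- G ` cball 0 t)"
      by (intro image_eqI[of _ _ "1 / v"]) (auto simp: V_def)
  qed
  have "0 \<in> G ` cball 0 t"
    using G(3) assms by (metis centre_in_cball image_eqI)
  then show "(\<lambda>w. 1 / w) ` (- G ` cball 0 t) \<subseteq> V t - {0}"
    by (auto simp: V_def)
qed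

lemma open_V:
  assumes "t \<le> 1" shows "open (V t)"
proof -
  obtain d where d: "d > 0" "ball 0 d \<subseteq> V t"
    using ball_subset_V[OF assms] by blast
  have "open (- {0} \<inter> (\<lambda>v. 1 / v) -` (- G ` cball 0 t))"
    using compact_K[OF assms]
    by (intro continuous_open_preimage continuous_intros) (auto intro: compact_imp_closed)
  moreover have "V t = (- {0} \<inter> (\<lambda>v. 1 / v) -` (- G ` cball 0 t)) \<union> ball 0 d"
    using d by (auto simp: V_def)
  ultimately show ?thesis by auto
qed

text \<open>The complement of the disc image is connected, and so is its image under
  \<open>1 / w\<close>; an overlapping disc about the origin adds the point at infinity.\<close>

lemma connected_V:
  assumes "0 \<le> t" "t \<le> 1" shows "connected (V t)"
proof -
  obtain d where d: "d > 0" "ball 0 d \<subseteq> V t"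
    using ball_subset_V[OF assms(2)] by blast
  have "0 \<in> G ` cball 0 t"
    using G(3) assms by (metis centre_in_cball image_eqI)
  then have "connected (V t - {0})"
    unfolding V_minus_0[OF assms(1)]
    by (intro connected_continuous_image connected_complement_K assms continuous_intros) auto
  moreover have "of_real (d / 2) \<in> (V t - {0}) \<inter> ball 0 d"
    using d by auto
  ultimately have "connected ((V t - {0}) \<union> ball 0 d)"
    by (intro connected_Un) auto
  moreover have "(V t - {0}) \<union> ball 0 d = V t"
    using d by auto
  ultimately show ?thesis by simp
qed

lemma G_nonzero:
  assumes "z \<in> cball 0 t - {0}" "t \<le> 1" shows "G z \<noteq> 0"
proof -
  have "norm z \<le> 1" using assms by simp
  then have "z \<in> U" "0 \<in> U" using U(2) by (auto simp: subset_eq)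
  then show ?thesis
    using inj_onD[OF G(2), of z 0] G(3) assms by auto
qed

lemma complement_V:
  assumes "t \<le> 1" shows "- V t = (\<lambda>z. 1 / G z) ` (cball 0 t - {0})"
proof
  show "- V t \<subseteq> (\<lambda>z. 1 / G z) ` (cball 0 t - {0})"
  proof
    fix v assume "v \<in> - V t"
    then obtain z where z: "v \<noteq> 0" "1 / v = G z" "z \<in> cball 0 t"
      by (auto simp: V_def)
    have "v = 1 / G z"
      using z(1) by (simp flip: z(2))
    moreover have "z \<noteq> 0"
      using z G(3) by auto
    ultimately show "v \<in> (\<lambda>z. 1 / G z) ` (cball 0 t - {0})"
      using z(3) by auto
  qed
  show "(\<lambda>z. 1 / G z) ` (cball 0 t - {0}) \<subseteq> - V t"
    using G_nonzero[OF _ assms] by (auto simp: V_def)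
qed

text \<open>The complement of \<open>V t\<close> is the image of a punctured disc under
  \<open>1 / G\<close>. It is connected, and unbounded since \<open>G\<close> vanishes at the
  origin, so it has no bounded component.\<close>

lemma simply_connected_V:
  assumes t: "0 < t" "t \<le> 1" shows "simply_connected (V t)"
  unfolding simply_connected_eq_unbounded_complement_components[OF open_V[OF t(2)]]
proof (intro conjI ballI notI)
  show "connected (V t)"
    using connected_V t by simp
  note G0 = G_nonzero[OF _ t(2)]
  have "aff_dim (cball (0::complex) t) \<noteq> 1"
    using t by (simp add: aff_dim_cball)
  then have "connected (cball (0::complex) t - {0})"
    by (intro connected_punctured_convex) auto
  moreover have "continuous_on (cball 0 t - {0}) (\<lambda>z. 1 / G z)"
  proof (intro continuous_intros continuous_on_subset[OF continuous_G])
    show "cball 0 t - {0} \<subseteq> U"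
      using t by (intro order_trans[OF _ U(2)]) auto
  qed (use G0 in blast)
  ultimately have "connected (- V t)"
    unfolding complement_V[OF t(2)] by (intro connected_continuous_image)
  moreover fix C assume C: "C \<in> components (- V t)"
  ultimately have "C = - V t"
    using connected_eq_components_subset_sing by blast
  moreover assume "bounded C"
  ultimately obtain M where M: "M > 0" "\<And>v. v \<in> - V t \<Longrightarrow> norm v \<le> M"
    unfolding bounded_pos by blast
  have "isCont G 0"
    using continuous_G U by (metis centre_in_cball continuous_on_eq_continuous_at subsetD zero_le_one)
  then obtain d where d: "d > 0" "\<And>z. dist z 0 < d \<Longrightarrow> dist (G z) (G 0) < 1 / M"
    unfolding continuous_at_eps_delta using M(1) by (metis divide_pos_pos zero_less_one)
  define z :: complex where "z = of_real (min d t / 2)"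
  have z: "z \<in> cball 0 t - {0}" "dist z 0 < d"
    using d t by (auto simp: z_def)
  then have "norm (1 / G z) \<le> M"
    using M(2) complement_V[OF t(2)] by blast
  moreover have "norm (G z) < 1 / M"
    using d(2)[OF z(2)] G(3) by simp
  ultimately show False
    using M(1) G0[OF z(1)] by (simp add: norm_divide field_simps)
qed

lemma V_1_iff: "v \<noteq> 0 \<Longrightarrow> v \<in> V 1 \<longleftrightarrow> norm (poly P (1 / v)) > 1"
  unfolding V_def using suplevel_eq by auto

lemma V_mono: "t \<le> t' \<Longrightarrow> V t' \<subseteq> V t"
  by (auto simp: V_def)

lemma bounded_V_1: "bounded (V 1)"
proof -
  have "0 \<in> G ` ball 0 1"
    using G(3) by (metis centre_in_ball image_eqI zero_less_one)
  then obtain d where d: "d > 0" "ball 0 d \<subseteq> G ` ball 0 1"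
    using open_G_ball[of 1] by (auto simp: open_contains_ball)
  have "V 1 \<subseteq> cball 0 (1 / d)"
  proof
    fix v assume v: "v \<in> V 1"
    show "v \<in> cball 0 (1 / d)"
    proof (cases "v = 0")
      case False
      then have "1 / v \<notin> ball 0 d"
        using v d(2) by (force simp: V_def)
      then show ?thesis
        using d(1) False by (simp add: norm_divide field_simps)
    qed (use d in auto)
  qed
  then show ?thesis
    using bounded_cball bounded_subset by blast
qed

text \<open>\<open>reflect_poly P\<close> continues \<open>v^n * poly P (1 / v)\<close> to the
  origin, where its value is the leading coefficient. It has no zeros on the simply connected
  \<open>V r\<close>, so a logarithm and with it an \<open>n\<close>-th root exist.\<close>

lemma root_exists:
  obtains H where "H holomorphic_on V r" "H 0 \<noteq> 0"
    "\<And>v. v \<in> V r \<Longrightarrow> v \<noteq> 0 \<Longrightarrow> H v ^ n = v ^ n * poly P (1 / v)"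
proof -
  have P0: "P \<noteq> 0" using deg n by auto
  have refl: "poly (reflect_poly P) v = v ^ n * poly P (1 / v)" if "v \<noteq> 0" for v
    using that deg by (simp add: poly_reflect_poly_nz inverse_eq_divide)
  have nz: "poly (reflect_poly P) v \<noteq> 0" if "v \<in> V r" for v
    using that zeros[of "1 / v"] refl[of v] P0 by (cases "v = 0") (auto simp: V_def)
  have "poly (reflect_poly P) holomorphic_on V r"
    by (intro holomorphic_intros)
  then obtain L where L: "L holomorphic_on V r" "\<And>v. v \<in> V r \<Longrightarrow> poly (reflect_poly P) v = exp (L v)"
    using simply_connected_V[of r] r nz simply_connected_eq_holomorphic_log[OF open_V[of r]] by auto
  show thesis
  proof (rule that[of "\<lambda>v. exp (L v / of_nat n)"])
    show "(\<lambda>v. exp (L v / of_nat n)) holomorphic_on V r"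
      using L(1) n by (intro holomorphic_intros) auto
    show "exp (L v / of_nat n) ^ n = v ^ n * poly P (1 / v)" if "v \<in> V r" "v \<noteq> 0" for v
      using L(2)[OF that(1)] refl[OF that(2)] n by (simp flip: exp_of_nat_mult)
  qed auto
qed

end

section \<open>The root of the polynomial as a conformal map of the exterior\<close>

text \<open>\<open>c\<close> is the linear coefficient of \<open>q\<close> at infinity; its
  positivity is the normalisation required of the exterior map.\<close>

locale lemniscate_root = lemniscate +
  fixes H :: "complex \<Rightarrow> complex" and c :: real
  assumes H: "H holomorphic_on V r" "H 0 = of_real c" "c > 0"
    "\<And>v. v \<in> V r \<Longrightarrow> v \<noteq> 0 \<Longrightarrow> H v ^ n = v ^ n * poly P (1 / v)"
begin

text \<open>The \<open>n\<close>-th root of \<open>P\<close> near infinity, where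
  \<open>v = 1 / w\<close>; multiplying by \<open>w\<close> undoes the factor \<open>v^n\<close> in
  the equation for \<open>H\<close>.\<close>

definition q :: "complex \<Rightarrow> complex" where "q w = w * H (1 / w)"

text \<open>The radius \<open>r < 1\<close> makes \<open>W\<close> an open neighbourhood of the
  closed exterior, so that \<open>q\<close> is holomorphic across the curve.\<close>

definition W :: "complex set" where "W = - G ` cball 0 r"

lemma W_nonzero: "w \<in> W \<Longrightarrow> w \<noteq> 0"
  using G(3) r by (metis ComplD W_def centre_in_cball image_eqI less_imp_le)

lemma inverse_in_V: "w \<in> W \<Longrightarrow> 1 / w \<in> V r"
  by (simp add: V_def W_def)

lemma open_W: "open W"
  unfolding W_def using compact_K r by (simp add: compact_imp_closed open_Compl)

lemma suplevel_subset_W: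
  assumes "norm (poly P w) \<ge> 1" shows "w \<in> W"
proof (rule ccontr)
  assume "w \<notin> W"
  then obtain z where "w = G z" "norm z \<le> r"
    by (auto simp: W_def)
  then show False
    using PG_less[of z] r(2) assms by simp
qed

lemma H_nonzero: "v \<in> V r \<Longrightarrow> H v \<noteq> 0"
proof (cases "v = 0")
  case False
  assume "v \<in> V r"
  then have "poly P (1 / v) \<noteq> 0"
    using zeros[of "1 / v"] False by (auto simp: V_def)
  then have "H v ^ n \<noteq> 0"
    using H(4)[OF \<open>v \<in> V r\<close> False] False by simp
  then show ?thesis using n by auto
qed (use H(2,3) in simp)

lemma q_holomorphic: "q holomorphic_on W"
proof -
  have "(\<lambda>w. H (1 / w)) holomorphic_on W"
    using W_nonzero inverse_in_V
    by (intro holomorphic_on_compose_gen[OF _ H(1), unfolded o_def] holomorphic_intros) auto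
  then show ?thesis unfolding q_def[abs_def] by (intro holomorphic_intros)
qed

lemma q_continuous: "continuous_on {w. norm (poly P w) \<ge> 1} q"
  using q_holomorphic suplevel_subset_W
  by (intro holomorphic_on_imp_continuous_on) (auto intro: holomorphic_on_subset)

lemma q_power: "w \<in> W \<Longrightarrow> q w ^ n = poly P w"
  using H(4)[OF inverse_in_V, of w] W_nonzero[of w]
  by (simp add: q_def power_mult_distrib field_simps)

lemma norm_q_power: "w \<in> W \<Longrightarrow> norm (q w) ^ n = norm (poly P w)"
  using q_power by (metis norm_power)

lemma norm_q:
  assumes "w \<in> W"
  shows "norm (q w) = 1 \<longleftrightarrow> norm (poly P w) = 1" "norm (q w) > 1 \<longleftrightarrow> norm (poly P w) > 1"
    "norm (q w) \<ge> 1 \<longleftrightarrow> norm (poly P w) \<ge> 1"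
proof -
  have "x ^ n = 1 \<longleftrightarrow> x = 1" "x ^ n > 1 \<longleftrightarrow> x > 1" if "x \<ge> 0" for x :: real
    using n that power_eq_iff_eq_base[of n x 1] power_mono_iff[of x 1 n] by (auto simp flip: not_le)
  then show "norm (q w) = 1 \<longleftrightarrow> norm (poly P w) = 1" "norm (q w) > 1 \<longleftrightarrow> norm (poly P w) > 1"
    unfolding norm_q_power[OF assms, symmetric] by auto
  then show "norm (q w) \<ge> 1 \<longleftrightarrow> norm (poly P w) \<ge> 1" by (auto simp: le_less)
qed

lemma q_open_map:
  assumes "open X" "X \<subseteq> W" shows "open (q ` X)"
proof (rule open_mapping_thm2[OF q_holomorphic open_W assms])
  fix Y assume Y: "open Y" "Y \<subseteq> W" "Y \<noteq> {}"
  show "\<not> q constant_on Y"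
  proof
    assume "q constant_on Y"
    then obtain d where "\<And>w. w \<in> Y \<Longrightarrow> q w = d"
      unfolding constant_on_def by blast
    then have "\<And>w. w \<in> Y \<Longrightarrow> poly P w = d ^ n"
      using q_power Y(2) by (metis subsetD)
    then show False
      using P_nonconstant[OF Y(1,3)] unfolding constant_on_def by blast
  qed
qed

text \<open>Away from the origin \<open>v / H v\<close> is \<open>1 / q (1 / v)\<close>. The
  compactness expresses that this map from \<open>V 1\<close> to the disc is proper.\<close>

lemma compact_exterior_sublevel:
  assumes "0 < d" "d < 1"
  shows "compact {v \<in> V 1. norm (v / H v) \<le> d}"
proof -
  have refl: "poly (reflect_poly P) v = v ^ n * poly P (1 / v)" if "v \<noteq> 0" for v
    using that deg by (simp add: poly_reflect_poly_nz inverse_eq_divide)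
  have VV: "V 1 \<subseteq> V r" using V_mono r by simp
  \<comment> \<open>Taking \<open>n\<close>-th powers replaces \<open>H\<close> by a polynomial, so
    the set is closed in the whole plane; the inequality itself forces membership in the bounded set
    \<open>V 1\<close>.\<close>
  let ?K = "{v. norm v ^ n \<le> d ^ n * norm (poly (reflect_poly P) v)}"
  have iff: "v \<in> ?K \<longleftrightarrow> norm (v / H v) \<le> d" if "v \<in> V 1" for v
  proof (cases "v = 0")
    case False
    have "H v \<noteq> 0" using H_nonzero VV that by blast
    have "norm (poly (reflect_poly P) v) = norm (H v) ^ n"
      using H(4)[of v] VV that False refl[OF False] by (metis norm_power subsetD)
    then have "v \<in> ?K \<longleftrightarrow> norm v ^ n \<le> (d * norm (H v)) ^ n"
      by (simp add: power_mult_distrib)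
    also have "\<dots> \<longleftrightarrow> norm v \<le> d * norm (H v)"
      using n assms by (intro power_mono_iff) auto
    also have "\<dots> \<longleftrightarrow> norm (v / H v) \<le> d"
      using \<open>H v \<noteq> 0\<close> by (simp add: norm_divide field_simps)
    finally show ?thesis .
  qed (use assms n in \<open>auto simp: power_0_left\<close>)
  have KV: "?K \<subseteq> V 1"
  proof
    fix v assume v: "v \<in> ?K"
    show "v \<in> V 1"
    proof (cases "v = 0")
      case False
      have "norm v ^ n \<le> norm v ^ n * (d ^ n * norm (poly P (1 / v)))"
        using v by (simp add: refl[OF False] norm_mult norm_power mult_ac)
      then have "1 \<le> d ^ n * norm (poly P (1 / v))"
        using False by (simp add: mult_le_cancel_left1)
      moreover have "d ^ n < 1"
        using assms n by (simp add: power_less_one_iff)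
      moreover have "d ^ n > 0" using assms by simp
      ultimately have "norm (poly P (1 / v)) > 1"
        using mult_left_mono[of "norm (poly P (1 / v))" 1 "d ^ n"] by linarith
      then show ?thesis using V_1_iff False by blast
    qed (simp add: V_def)
  qed
  have "closed ?K"
    by (intro closed_Collect_le continuous_intros)
  then have "compact ?K"
    using bounded_subset[OF bounded_V_1 KV] compact_eq_bounded_closed by blast
  moreover have "{v \<in> V 1. norm (v / H v) \<le> d} = ?K"
    using iff KV by blast
  ultimately show ?thesis by simp
qed

text \<open>
  Composed with a Riemann map of \<open>V 1\<close>, the map \<open>v \<mapsto> v / H v\<close> becomes a proper self-map of the
  disc whose only zero is a simple one at the origin, that is, a rotation.
\<close>

lemma exterior_inverse:
  obtains E where "E holomorphic_on ball 0 1" "E 0 = of_real (1 / c)"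
    "\<And>z. norm z > 1 \<Longrightarrow> norm (poly P (z * E (1 / z))) > 1 \<and> q (z * E (1 / z)) = z"
    "\<And>w. norm (poly P w) > 1 \<Longrightarrow> q w * E (1 / q w) = w"
proof -
  let ?h = "\<lambda>v. v / H v"
  have VV: "V 1 \<subseteq> V r" using V_mono r by simp
  have "(1::complex) / G 1 \<notin> V 1"
    using complement_V[of 1] by force
  then have UN: "V 1 \<noteq> UNIV" by auto
  have V0: "0 \<in> V 1" by (simp add: V_def)
  have V1: "open (V 1)" "simply_connected (V 1)"
    by (simp_all add: open_V simply_connected_V)
  obtain \<psi> R where \<psi>: "\<psi> holomorphic_on V 1" "\<psi> ` V 1 = ball 0 1"
    and R: "R holomorphic_on ball 0 1" "R ` ball 0 1 = V 1" "R 0 = 0"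
    and R\<psi>: "\<And>v. v \<in> V 1 \<Longrightarrow> R (\<psi> v) = v" and \<psi>R: "\<And>z. z \<in> ball 0 1 \<Longrightarrow> \<psi> (R z) = z"
    using Riemann_map_centred[OF V1 UN V0] by metis
  have RV: "R z \<in> V 1" if "z \<in> ball 0 1" for z
    using R(2) that by blast
  have injR: "inj_on R (ball 0 1)"
    using \<psi>R by (metis inj_onI)
  obtain k where k: "k holomorphic_on ball 0 1" "\<And>z. z \<in> ball 0 1 \<Longrightarrow> k z \<noteq> 0"
    "\<And>z. z \<in> ball 0 1 \<Longrightarrow> R z = z * k z"
    using injective_holomorphic_factor[OF R(1) open_ball injR, of 0] R(3) by auto
  \<comment> \<open>\<open>X\<close> is \<open>?h \<circ> R\<close> with its zero at the origin
    divided out. It has no zeros and boundary modulus 1, so it is a constant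
    \<open>u\<close>.\<close>
  define X where "X z = k z / H (R z)" for z
  have HR: "H (R z) \<noteq> 0" if "z \<in> ball 0 1" for z
    using H_nonzero RV[OF that] VV by blast
  have hR: "?h (R z) = z * X z" if "z \<in> ball 0 1" for z
    using k(3)[OF that] by (simp add: X_def)
  have X0: "X z \<noteq> 0" if "z \<in> ball 0 1" for z
    using k(2) HR that by (simp add: X_def)
  have "(\<lambda>z. H (R z)) holomorphic_on ball 0 1"
    using RV VV by (intro holomorphic_on_compose_gen[OF R(1) H(1), unfolded o_def]) auto
  then have Xhol: "X holomorphic_on ball 0 1"
    unfolding X_def[abs_def] using k(1) HR by (intro holomorphic_intros) auto
  have h1: "norm (?h v) < 1" if "v \<in> V 1" for v
  proof (cases "v = 0")
    case False
    then have "norm (poly P (1 / v)) > 1" using V_1_iff that by blast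
    then have "norm (q (1 / v)) > 1"
      using norm_q(2) suplevel_subset_W by (simp add: less_imp_le)
    then show ?thesis
      using False H_nonzero VV that by (auto simp add: q_def norm_divide field_simps)
  qed simp
  have hlim: "((\<lambda>z. norm (?h (R z))) \<longlongrightarrow> 1) to_circle"
  proof (rule order_tendstoI)
    fix d :: real assume "d < 1"
    define d' where "d' = max d (1/2)"
    have d': "0 < d'" "d' < 1" "d \<le> d'" using \<open>d < 1\<close> by (auto simp: d'_def)
    have "eventually (\<lambda>z. R z \<notin> {v \<in> V 1. norm (?h v) \<le> d'}) to_circle"
      using \<psi> \<psi>R compact_exterior_sublevel[OF d'(1,2)]
      by (intro eventually_avoids_compact[of "V 1" \<psi>] holomorphic_on_imp_continuous_on) auto
    then show "eventually (\<lambda>z. d < norm (?h (R z))) to_circle"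
      using eventually_to_circle_in_ball by eventually_elim (use RV d'(3) in force)
  next
    fix d :: real assume "1 < d"
    show "eventually (\<lambda>z. norm (?h (R z)) < d) to_circle"
      using eventually_to_circle_in_ball
      by eventually_elim (use RV h1 \<open>1 < d\<close> less_trans in blast)
  qed
  have norm1: "(norm \<longlongrightarrow> 1) to_circle"
    using filterlim_filtercomap[of norm "at_left (1::real)"] filterlim_mono
    by (metis at_within_le_nhds order_refl)
  have "((\<lambda>z. norm (?h (R z)) / norm z) \<longlongrightarrow> 1 / 1) to_circle"
    by (intro tendsto_divide hlim norm1) auto
  moreover have "eventually (\<lambda>z. norm (?h (R z)) / norm z = norm (X z)) to_circle"
    using eventually_to_circle_in_ball order_tendstoD(1)[OF norm1 zero_less_one]
    by eventually_elim (simp add: hR norm_mult del: times_divide_eq_left)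
  ultimately have Xlim: "((\<lambda>z. norm (X z)) \<longlongrightarrow> 1) to_circle"
    by (force elim: Lim_transform_eventually)
  obtain u where u: "norm u = 1" "\<And>z. z \<in> ball 0 1 \<Longrightarrow> X z = u"
    using unimodular_boundary_imp_constant[OF Xhol X0 Xlim] by blast
  have u0: "u \<noteq> 0" using u(1) by auto
  have in_ball: "z / u \<in> ball 0 1 \<longleftrightarrow> z \<in> ball 0 1" for z
    using u(1) by (simp add: norm_divide)
  \<comment> \<open>Since \<open>?h (R z) = u * z\<close>, the inverse of \<open>?h\<close> is
    \<open>R (z / u)\<close>. \<open>E z\<close> is \<open>z / R (z / u)\<close> with the
    singularity at 0 removed, and \<open>z * E (1 / z)\<close> inverts \<open>q\<close>.\<close>
  define E where "E z = u / k (z / u)" for z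
  have E_eq: "z * E (1 / z) = 1 / R (1 / z / u)" if "norm z > 1" for z
  proof -
    have "1 / z / u \<in> ball 0 1"
      unfolding in_ball using that by (auto simp: norm_divide divide_simps)
    then show ?thesis
      using k(3)[of "1 / z / u"] u0 that by (auto simp: E_def field_simps)
  qed
  show thesis
  proof (rule that[of E])
    have "(\<lambda>z. k (z / u)) holomorphic_on ball 0 1"
      using in_ball u0 by (intro holomorphic_on_compose_gen[OF _ k(1), unfolded o_def] holomorphic_intros) auto
    then show "E holomorphic_on ball 0 1"
      unfolding E_def[abs_def] using k(2) in_ball by (intro holomorphic_intros) auto
    show "E 0 = of_real (1 / c)"
      using u(2)[of 0] u0 R(3) H(2,3) by (auto simp: E_def X_def field_simps)
    show "norm (poly P (z * E (1 / z))) > 1 \<and> q (z * E (1 / z)) = z" if z: "norm z > 1" for z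
    proof -
      let ?y = "1 / z / u"
      have y: "?y \<in> ball 0 1"
        unfolding in_ball using z by (auto simp: norm_divide divide_simps)
      have z0: "z \<noteq> 0" using z by auto
      have R0: "R ?y \<noteq> 0"
        using k(2,3)[OF y] u0 z0 by simp
      have "?h (R ?y) = 1 / z"
        using hR[OF y] u(2)[OF y] u0 by simp
      then have "H (R ?y) / R ?y = z"
        using R0 z0 HR[OF y] by (simp add: field_simps)
      then show ?thesis
        unfolding E_eq[OF z] q_def using V_1_iff[OF R0] RV[OF y] by simp
    qed
    show "q w * E (1 / q w) = w" if w: "norm (poly P w) > 1" for w
    proof -
      have W: "w \<in> W" using suplevel_subset_W w by simp
      then have w0: "w \<noteq> 0" by (rule W_nonzero)
      have q1: "norm (q w) > 1" using norm_q(2)[OF W] w by simp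
      have v: "1 / w \<in> V 1" using V_1_iff[of "1 / w"] w w0 by simp
      have y: "\<psi> (1 / w) \<in> ball 0 1" using \<psi>(2) v by blast
      have "1 / q w = ?h (1 / w)" by (simp add: q_def)
      also have "\<dots> = u * \<psi> (1 / w)"
        using hR[OF y] u(2)[OF y] R\<psi>[OF v] by simp
      finally have "1 / q w / u = \<psi> (1 / w)" using u0 by simp
      then show ?thesis
        unfolding E_eq[OF q1] using R\<psi>[OF v] by simp
    qed
  qed
qed

end

section \<open>Boundary correspondence and the exterior map\<close>

context lemniscate_root
begin

lemma q_inj_exterior: "inj_on q {w. norm (poly P w) > 1}"
proof -
  obtain E where "\<And>w. norm (poly P w) > 1 \<Longrightarrow> q w * E (1 / q w) = w"
    using exterior_inverse by metis
  then show ?thesis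
    by (metis (mono_tags, lifting) inj_onI mem_Collect_eq)
qed

lemma q_image_exterior: "q ` {w. norm (poly P w) > 1} = {z. norm z > 1}"
proof
  show "q ` {w. norm (poly P w) > 1} \<subseteq> {z. norm z > 1}"
    using norm_q(2) suplevel_subset_W by (auto simp: less_imp_le)
  obtain E where "\<And>z. norm z > 1 \<Longrightarrow> norm (poly P (z * E (1 / z))) > 1 \<and> q (z * E (1 / z)) = z"
    using exterior_inverse by metis
  then show "{z. norm z > 1} \<subseteq> q ` {w. norm (poly P w) > 1}"
    by (metis (mono_tags, lifting) image_eqI mem_Collect_eq subsetI)
qed

text \<open>
  On the lemniscate itself \<open>q\<close> stays injective: two boundary points with a common value would, \<open>q\<close>
  being an open map, produce two exterior points with a common value.
\<close>

lemma q_inj: "inj_on q {w. norm (poly P w) \<ge> 1}"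
proof (rule inj_onI)
  fix w1 w2 assume w: "w1 \<in> {w. norm (poly P w) \<ge> 1}" "w2 \<in> {w. norm (poly P w) \<ge> 1}"
    and eq: "q w1 = q w2"
  then have W12: "w1 \<in> W" "w2 \<in> W" using suplevel_subset_W by auto
  show "w1 = w2"
  proof (rule ccontr)
    assume "w1 \<noteq> w2"
    then obtain N1 N2 where N: "open N1" "open N2" "w1 \<in> N1" "w2 \<in> N2" "N1 \<inter> N2 = {}"
      using separation_t2[of w1 w2] by auto
    define Q where "Q = q ` (N1 \<inter> W) \<inter> q ` (N2 \<inter> W)"
    have "open Q"
      unfolding Q_def using N open_W by (intro open_Int q_open_map) auto
    moreover have "q w1 \<in> Q"
      using N W12 eq unfolding Q_def by (metis IntI image_eqI)
    ultimately obtain d where d: "d > 0" "ball (q w1) d \<subseteq> Q"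
      by (meson openE)
    have q1: "norm (q w1) \<ge> 1"
      using norm_q(3)[OF W12(1)] w by simp
    \<comment> \<open>This factor above 1 moves the common value radially outward by
      \<open>d / 2\<close>, which stays within the ball of radius \<open>d\<close>.\<close>
    define t where "t = 1 + d / (2 * norm (q w1))"
    have "norm (q w1) > 0" using q1 by linarith
    then have t: "t > 1" using d(1) by (simp add: t_def)
    have "dist (q w1) (of_real t * q w1) = (t - 1) * norm (q w1)"
    proof -
      have "q w1 - of_real t * q w1 = of_real (1 - t) * q w1" by (simp add: algebra_simps)
      then show ?thesis using t by (simp add: dist_norm norm_mult del: of_real_diff)
    qed
    also have "\<dots> < d" using d(1) q1 by (auto simp: t_def)
    finally have "of_real t * q w1 \<in> Q" using d(2) by auto
    then have "of_real t * q w1 \<in> q ` (N1 \<inter> W)" "of_real t * q w1 \<in> q ` (N2 \<inter> W)"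
      unfolding Q_def by blast+
    then obtain x1 x2 where x: "x1 \<in> N1 \<inter> W" "q x1 = of_real t * q w1"
        "x2 \<in> N2 \<inter> W" "q x2 = of_real t * q w1"
      by (elim imageE) simp
    have "norm (of_real t * q w1) \<ge> t * 1"
      unfolding norm_mult using t q1 by (intro mult_mono) auto
    then have "norm (poly P x1) > 1" "norm (poly P x2) > 1"
      using norm_q(2)[of x1] norm_q(2)[of x2] x t by auto
    then have "x1 = x2"
      using q_inj_exterior x unfolding inj_on_def by auto
    then show False using x N by auto
  qed
qed

lemma q_image: "q ` {w. norm (poly P w) \<ge> 1} = {z. norm z \<ge> 1}"
proof
  show "q ` {w. norm (poly P w) \<ge> 1} \<subseteq> {z. norm z \<ge> 1}"
    using norm_q(3) suplevel_subset_W by auto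
  \<comment> \<open>The image of this compact set is closed and contains all \<open>z\<close> with
    \<open>1 < |z| \<le> 2\<close>, hence also the circle. The bound \<open>2^n\<close> is the value
    of \<open>|P|\<close> where \<open>|q| = 2\<close>.\<close>
  define A where "A = {w. 1 \<le> norm (poly P w) \<and> norm (poly P w) \<le> 2 ^ n}"
  have "closed A"
    unfolding A_def by (intro closed_Collect_conj closed_Collect_le poly_continuous continuous_on_const)
  moreover have "bounded A"
    by (rule bounded_subset[OF bounded_sublevel[of "2 ^ n"]]) (auto simp: A_def)
  ultimately have "compact A" by (simp add: compact_eq_bounded_closed)
  then have "compact (q ` A)"
    by (rule compact_continuous_image[rotated]) (rule continuous_on_subset[OF q_continuous], auto simp: A_def)
  then have closed: "closed (q ` A)" by (rule compact_imp_closed)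
  have A2: "z \<in> q ` A" if z: "1 < norm z" "norm z \<le> 2" for z
  proof -
    obtain w where w: "norm (poly P w) > 1" "q w = z"
      using z(1) q_image_exterior by (metis (mono_tags, lifting) imageE mem_Collect_eq)
    then have "norm (poly P w) = norm z ^ n"
      using norm_q_power suplevel_subset_W by (metis less_imp_le)
    also have "\<dots> \<le> 2 ^ n" using z by (intro power_mono) auto
    finally show ?thesis using w by (auto simp: A_def)
  qed
  show "{z. norm z \<ge> 1} \<subseteq> q ` {w. norm (poly P w) \<ge> 1}"
  proof
    fix z assume "z \<in> {z. norm (z::complex) \<ge> 1}"
    then consider "norm z > 1" | "norm z = 1" by force
    then show "z \<in> q ` {w. norm (poly P w) \<ge> 1}"
    proof cases
      case 1
      then have "z \<in> q ` {w. norm (poly P w) > 1}" using q_image_exterior by simp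
      then show ?thesis by (auto simp: less_imp_le)
    next
      case 2
      have lim: "(\<lambda>m. of_real (1 + inverse (real (Suc m))) * z) \<longlonglongrightarrow> of_real (1 + 0) * z"
        by (intro tendsto_intros LIMSEQ_inverse_real_of_nat)
      have mem: "of_real (1 + inverse (real (Suc m))) * z \<in> q ` A" for m
      proof (rule A2)
        have "norm (of_real (1 + inverse (real (Suc m))) * z) = 1 + inverse (real (Suc m))"
          using 2 by (simp add: norm_mult del: of_real_add)
        moreover have "0 < inverse (real (Suc m))" "inverse (real (Suc m)) \<le> 1"
          by (auto simp: field_simps)
        ultimately show "1 < norm (of_real (1 + inverse (real (Suc m))) * z)"
          "norm (of_real (1 + inverse (real (Suc m))) * z) \<le> 2" by linarith+
      qed
      have "of_real (1 + 0) * z \<in> q ` A"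
        by (rule closed_sequentially[OF closed mem lim])
      then show ?thesis by (auto simp: A_def)
    qed
  qed
qed

text \<open>\<open>q\<close> is open on the neighbourhood \<open>W\<close> of the closed exterior,
  and within \<open>W\<close> its modulus is at least 1 exactly there, so it is also open between
  the closed exteriors.\<close>

lemma q_homeomorphism:
  obtains g where "homeomorphism {w. norm (poly P w) \<ge> 1} {z. norm z \<ge> 1} q g"
proof -
  have op: "openin (top_of_set {z. norm z \<ge> 1}) (q ` X)"
    if X: "openin (top_of_set {w. norm (poly P w) \<ge> 1}) X" for X
  proof -
    obtain Y where Y: "open Y" "X = {w. norm (poly P w) \<ge> 1} \<inter> Y"
      using X by (auto simp: openin_open)
    have "q ` X = {z. norm z \<ge> 1} \<inter> q ` (Y \<inter> W)"
    proof
      show "q ` X \<subseteq> {z. norm z \<ge> 1} \<inter> q ` (Y \<inter> W)"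
        unfolding Y(2) using norm_q(3) suplevel_subset_W by auto
      have "w \<in> X" if "w \<in> Y \<inter> W" "norm (q w) \<ge> 1" for w
        unfolding Y(2) using norm_q(3) that by auto
      then show "{z. norm z \<ge> 1} \<inter> q ` (Y \<inter> W) \<subseteq> q ` X"
        by auto
    qed
    moreover have "open (q ` (Y \<inter> W))"
      using Y(1) open_W by (intro q_open_map) auto
    ultimately show ?thesis
      by (auto simp: openin_open)
  qed
  obtain g where "homeomorphism {w. norm (poly P w) \<ge> 1} {z. norm z \<ge> 1} q g"
    by (rule homeomorphism_injective_open_map[OF q_continuous q_image q_inj op])
  then show thesis
    by (rule that)
qed

lemma exterior_map_\<Gamma>: "\<exists>g. exterior_map \<Gamma> g q"
proof -
  obtain g where hom: "homeomorphism {w. norm (poly P w) \<ge> 1} {z. norm z \<ge> 1} q g"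
    using q_homeomorphism .
  obtain E where E: "E holomorphic_on ball 0 1" "E 0 = of_real (1 / c)"
    and gE: "\<And>z. norm z > 1 \<Longrightarrow> norm (poly P (z * E (1 / z))) > 1 \<and> q (z * E (1 / z)) = z"
    using exterior_inverse by metis
  have g_eq: "g z = z * E (1 / z)" if "norm z > 1" for z
    using gE[OF that] homeomorphism_apply1[OF hom, of "z * E (1 / z)"] by simp
  have "exterior_map \<Gamma> g q"
    unfolding exterior_map_def closure_exterior_\<Gamma>
    unfolding exterior_\<Gamma>
  proof (intro conjI)
    have "(\<lambda>z. z * E (1 / z)) holomorphic_on {z. norm z > 1}"
      by (intro holomorphic_intros holomorphic_on_compose_gen[OF _ E(1), unfolded o_def])
        (auto simp: norm_divide divide_simps)
    then show "g holomorphic_on {z. norm z > 1}"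
      by (rule holomorphic_transform) (simp add: g_eq)
    show hom': "homeomorphism {z. norm z \<ge> 1} {w. norm (poly P w) \<ge> 1} g q"
      using hom by (rule homeomorphism_symD)
    show "bij_betw g {z. norm z > 1} {w. norm (poly P w) > 1}"
    proof (rule bij_betw_imageI)
      show "inj_on g {z. norm z > 1}"
        using homeomorphism_apply2[OF hom] by (metis (mono_tags, lifting) inj_onI less_imp_le mem_Collect_eq)
      have "w \<in> g ` {z. norm z > 1}" if "norm (poly P w) > 1" for w
      proof -
        have "g (q w) = w" using homeomorphism_apply1[OF hom, of w] that by simp
        moreover have "norm (q w) > 1"
          using that norm_q(2) suplevel_subset_W by simp
        ultimately show ?thesis by (metis (mono_tags) image_eqI mem_Collect_eq)
      qed
      then show "g ` {z. norm z > 1} = {w. norm (poly P w) > 1}"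
        using gE g_eq by auto
    qed
    \<comment> \<open>The factor \<open>z\<close> in \<open>g z = z * E (1 / z)\<close> shifts the
      Taylor coefficients of \<open>E\<close> by one: \<open>e 0\<close> gives the linear term and
      \<open>e (Suc m)\<close> the coefficient of \<open>1 / z^m\<close>.\<close>
    define e where "e m = (deriv ^^ m) E 0 / fact m" for m
    have sums: "(\<lambda>m. e (Suc m) / z ^ m) sums (g z - of_real (1 / c) * z)" if z: "norm z > 1" for z
    proof -
      have z0: "z \<noteq> 0" using z by auto
      have "(\<lambda>m. e m * (1 / z - 0) ^ m) sums E (1 / z)"
        unfolding e_def by (rule holomorphic_power_series[OF E(1)]) (use z in \<open>auto simp: norm_divide divide_simps\<close>)
      moreover have "e 0 = of_real (1 / c)" using E(2) by (simp add: e_def)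
      ultimately have "(\<lambda>m. e (Suc m) * (1 / z) ^ Suc m) sums (E (1 / z) - of_real (1 / c))"
        by (subst sums_Suc_iff) simp
      then have "(\<lambda>m. z * (e (Suc m) * (1 / z) ^ Suc m)) sums (z * (E (1 / z) - of_real (1 / c)))"
        by (rule sums_mult)
      moreover have "z * (e (Suc m) * (1 / z) ^ Suc m) = e (Suc m) / z ^ m" for m
        using z0 by (simp add: power_divide)
      ultimately show ?thesis
        unfolding g_eq[OF z] by (simp add: algebra_simps)
    qed
    show "\<exists>a c R. a > (0::real) \<and>
        (\<forall>z. norm z > R \<longrightarrow> (\<lambda>m. c m / z ^ m) sums (g z - complex_of_real a * z))"
      using sums H(3)
      by (intro exI[of _ "1 / c"], intro exI[of _ "\<lambda>m. e (Suc m)"], intro exI[of _ 1]) simp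
  qed
  then show ?thesis by blast
qed

lemma interior_map_\<Gamma>: "\<exists>G'. interior_map \<Gamma> G G'"
proof -
  have cont: "continuous_on (cball 0 1) G" and inj: "inj_on G (cball 0 1)"
    using continuous_G G(2) U(2) continuous_on_subset inj_on_subset by blast+
  obtain G' where "homeomorphism (cball 0 1) (G ` cball 0 1) G G'"
    using homeomorphism_compact[OF compact_cball cont refl inj] by blast
  moreover have "closure (inside \<Gamma>) = G ` cball 0 1"
    unfolding closure_inside_\<Gamma> sublevel_closed_eq ..
  moreover have "bij_betw G (ball 0 1) (inside \<Gamma>)"
    unfolding inside_\<Gamma> sublevel_eq using inj_on_subset[OF inj ball_subset_cball] by (simp add: bij_betw_def)
  moreover have "G holomorphic_on ball 0 1"
    using G(1) U(2) by (meson ball_subset_cball holomorphic_on_subset order_trans)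
  ultimately show ?thesis
    unfolding interior_map_def by auto
qed

lemma disc_automorphism_id: "disc_automorphism (\<lambda>z. z)"
  unfolding disc_automorphism_def by (intro exI[of _ 1] exI[of _ 0]) simp

lemma fingerprint_\<Gamma>:
  assumes "\<And>z. z \<in> sphere 0 1 \<Longrightarrow> k z = q (G z)"
  shows "k \<in> fingerprint \<Gamma>"
proof -
  have "welding_map \<Gamma> k"
    unfolding welding_map_def using interior_map_\<Gamma> exterior_map_\<Gamma> assms by blast
  moreover have "moebius_related k k"
    unfolding moebius_related_def using disc_automorphism_id by blast
  ultimately show ?thesis
    unfolding fingerprint_def by blast
qed

end

section \<open>Uniqueness\<close>

text \<open>The exponential map straightens the circle to a line.\<close>

lemma holomorphic_across_circle:
  assumes U: "open U" and cont: "continuous_on U f" and hol: "f holomorphic_on U - sphere 0 1"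
  shows "f holomorphic_on U"
proof -
  let ?S = "exp -` U"
  have S: "open ?S"
    using U by (intro open_vimage continuous_intros) auto
  have exp_hol: "(\<lambda>z. f (exp z)) holomorphic_on T" if "T \<subseteq> ?S" "\<And>z. z \<in> T \<Longrightarrow> Re z \<noteq> 0" for T
    by (rule holomorphic_on_compose_gen[OF _ hol, unfolded o_def])
      (use that in \<open>auto intro!: holomorphic_intros\<close>)
  have F: "(\<lambda>z. f (exp z)) holomorphic_on ?S"
  proof (rule holomorphic_on_paste_across_line[OF S, of 1 _ 0])
    show "(\<lambda>z. f (exp z)) holomorphic_on ?S \<inter> {z. 1 \<bullet> z < 0}"
      "(\<lambda>z. f (exp z)) holomorphic_on ?S \<inter> {z. 0 < 1 \<bullet> z}"
      by (rule exp_hol; auto simp: inner_complex_def)+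
    show "continuous_on ?S (\<lambda>z. f (exp z))"
      by (rule continuous_on_compose2[OF cont]) (auto intro!: continuous_intros)
  qed simp
  have "f field_differentiable at z" if z: "z \<in> U" for z
  proof (cases "norm z = 1")
    case False
    have "open (U - sphere 0 1)" using U by auto
    then show ?thesis
      using hol z False by (metis Diff_iff holomorphic_on_imp_differentiable_at mem_sphere_0)
  next
    case True
    then have z0: "z \<noteq> 0" by auto
    obtain e where e: "e > 0" "ball z e \<subseteq> U" using U z openE by blast
    \<comment> \<open>Within distance 1 of \<open>z\<close> the quotient \<open>w / z\<close> has
      positive real part, so \<open>Ln (w / z) + Ln z\<close> is a holomorphic local inverse of
      \<open>exp\<close>.\<close>
    define B where "B = ball z (min e 1)"
    have pos: "w / z \<notin> \<real>\<^sub>\<le>\<^sub>0" if "w \<in> B" for w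
    proof -
      have "norm (1 - w / z) = norm (z - w)"
        using True z0 by (simp add: field_simps norm_divide flip: diff_divide_distrib)
      then have "norm (1 - w / z) < 1" using that by (simp add: B_def dist_norm)
      then have "Re (w / z) > 0" using complex_Re_le_cmod[of "1 - w / z"] by simp
      then show ?thesis by (auto simp: complex_nonpos_Reals_iff)
    qed
    have exp_eq: "exp (Ln (w / z) + Ln z) = w" if "w \<in> B" for w
    proof -
      have "w / z \<noteq> 0" using pos[OF that] by auto
      then show ?thesis using z0 by (simp add: exp_add)
    qed
    have "(\<lambda>w. f (exp (Ln (w / z) + Ln z))) holomorphic_on B"
      by (rule holomorphic_on_compose_gen[OF _ F, unfolded o_def])
        (use pos z0 exp_eq e in \<open>auto intro!: holomorphic_intros simp: B_def\<close>)
    then have "f holomorphic_on B"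
      by (rule holomorphic_transform) (simp add: exp_eq)
    then show ?thesis
      by (rule holomorphic_on_imp_differentiable_at) (use e in \<open>auto simp: B_def\<close>)
  qed
  then show ?thesis
    by (meson field_differentiable_at_within holomorphic_on_def)
qed

section \<open>Boundary facts and growth at infinity for the gluing\<close>

lemma disc_automorphism_facts:
  assumes "disc_automorphism \<phi>"
  shows "continuous_on (cball 0 1) \<phi>" "\<phi> holomorphic_on ball 0 1"
    "\<And>z. norm z < 1 \<Longrightarrow> norm (\<phi> z) < 1" "\<And>z. norm z = 1 \<Longrightarrow> norm (\<phi> z) = 1"
proof -
  obtain u a where ua: "norm u = 1" "norm a < 1" "\<And>z. \<phi> z = u * blaschke_factor a z"
    using assms unfolding disc_automorphism_def blaschke_factor_def by auto
  have \<phi>: "\<phi> = (\<lambda>z. u * ((z - a) / (1 - cnj a * z)))"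
    using ua(3) by (auto simp: blaschke_factor_def)
  have nz: "1 - cnj a * z \<noteq> 0" if "norm z \<le> 1" for z
  proof (rule blaschke_denominator_nonzero)
    have "norm a * norm z \<le> norm a * 1" using that by (intro mult_left_mono) auto
    then show "norm a * norm z < 1" using ua(2) by simp
  qed
  show "continuous_on (cball 0 1) \<phi>"
    unfolding \<phi> using nz by (intro continuous_intros) auto
  show "\<phi> holomorphic_on ball 0 1"
    unfolding \<phi> using nz by (intro holomorphic_intros) auto
  show "norm (\<phi> z) < 1" if "norm z < 1" for z
    using blaschke_factor_less_1[OF ua(2) that] ua by (simp add: norm_mult)
  show "norm (\<phi> z) = 1" if "norm z = 1" for z
    using blaschke_factor_eq_1[OF ua(2) that] ua by (simp add: norm_mult)
qed

lemma jordan_curve_facts: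
  assumes "C1_jordan_curve \<Gamma>"
  shows "closure (inside \<Gamma>) = inside \<Gamma> \<union> \<Gamma>" "inside \<Gamma> \<inter> \<Gamma> = {}"
    "closure (- closure (inside \<Gamma>)) = - closure (inside \<Gamma>) \<union> \<Gamma>" "- closure (inside \<Gamma>) \<inter> \<Gamma> = {}"
proof -
  obtain \<gamma> where \<gamma>: "simple_path \<gamma>" "pathfinish \<gamma> = pathstart \<gamma>" "path_image \<gamma> = \<Gamma>"
    using assms unfolding C1_jordan_curve_def by blast
  note J = Jordan_inside_outside[OF \<gamma>(1,2), unfolded \<gamma>(3)]
  show 1: "closure (inside \<Gamma>) = inside \<Gamma> \<union> \<Gamma>"
    using J closure_Un_frontier by metis
  show "inside \<Gamma> \<inter> \<Gamma> = {}" by (rule inside_no_overlap)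
  have out: "- closure (inside \<Gamma>) = outside \<Gamma>"
    unfolding 1 outside_inside by auto
  show "closure (- closure (inside \<Gamma>)) = - closure (inside \<Gamma>) \<union> \<Gamma>"
    unfolding out using J closure_Un_frontier by metis
  show "- closure (inside \<Gamma>) \<inter> \<Gamma> = {}" unfolding 1 by auto
qed

lemma homeomorphism_boundary_image:
  assumes hom: "homeomorphism S T f f'" and bij: "bij_betw f S' T'" and "S' \<subseteq> S" "T' \<subseteq> T"
  shows "f ` (S - S') = T - T'"
proof -
  have "inj_on f S"
    using homeomorphism_apply1[OF hom] by (metis inj_onI)
  then have "f ` (S - S') = f ` S - f ` S'"
    using assms(3) by (intro inj_on_image_set_diff) auto
  then show ?thesis
    using homeomorphism_image1[OF hom] bij by (simp add: bij_betw_def)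
qed

text \<open>In the variable \<open>1 / z\<close> the remainder \<open>g z - a z\<close> is a power
  series, so it has a finite limit at infinity and disappears after division by
  \<open>z\<close>.\<close>

lemma exterior_expansion_tendsto:
  assumes "\<And>z. norm z > R \<Longrightarrow> (\<lambda>m. c m / z ^ m) sums (g z - of_real a * z :: complex)"
  shows "((\<lambda>z. g z / z) \<longlongrightarrow> of_real a) at_infinity"
proof -
  define M where "M = max R 1"
  have M: "M > 0" "R \<le> M" by (auto simp: M_def)
  define s where "s = 1 / M"
  define f where "f \<zeta> = (if \<zeta> = 0 then c 0 else g (1 / \<zeta>) - of_real a * (1 / \<zeta>))" for \<zeta> :: complex
  have s: "s > 0" using M(1) by (simp add: s_def)
  have "(f \<longlongrightarrow> c 0) (at 0)"
  proof (rule powser_limit_0[OF s])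
    fix \<zeta> :: complex assume \<zeta>: "norm \<zeta> < s"
    show "(\<lambda>m. c m * \<zeta> ^ m) sums f \<zeta>"
    proof (cases "\<zeta> = 0")
      case True
      then show ?thesis using powser_sums_zero[of c] by (simp add: f_def)
    next
      case False
      then have "norm (1 / \<zeta>) > M"
        using \<zeta> M(1) by (simp add: s_def norm_divide field_simps)
      then have "(\<lambda>m. c m / (1 / \<zeta>) ^ m) sums (g (1 / \<zeta>) - of_real a * (1 / \<zeta>))"
        using M(2) by (intro assms) simp
      then show ?thesis using False by (simp add: f_def power_divide)
    qed
  qed
  then have "((\<lambda>\<zeta>. of_real a + \<zeta> * f \<zeta>) \<longlongrightarrow> of_real a + 0 * c 0) (at 0)"
    by (intro tendsto_intros)
  moreover have "eventually (\<lambda>\<zeta>. of_real a + \<zeta> * f \<zeta> = ((\<lambda>z. g z / z) \<circ> inverse) \<zeta>) (at 0)"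
    by (rule eventually_at_filter[THEN iffD2], rule always_eventually)
      (auto simp: f_def field_simps)
  ultimately have "(((\<lambda>z. g z / z) \<circ> inverse) \<longlongrightarrow> of_real a + 0 * c 0) (at 0)"
    by (rule Lim_transform_eventually)
  then show ?thesis
    by (simp add: lim_at_infinity_0)
qed

text \<open>By the theorem of Liouville, linear growth leaves a polynomial of degree at most one;
  the limit of the quotient is its slope.\<close>

lemma linear_growth_imp_affine:
  assumes F: "F holomorphic_on UNIV" and lim: "((\<lambda>w. F w / w) \<longlongrightarrow> l) at_infinity"
  obtains b where "\<And>w. F w = l * w + b"
proof -
  have "eventually (\<lambda>w. norm (F w / w) < norm l + 1) at_infinity"
    by (rule order_tendstoD(2)[OF tendsto_norm[OF lim]]) simp
  then obtain A where A: "\<And>w. norm w \<ge> A \<Longrightarrow> norm (F w / w) < norm l + 1"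
    unfolding eventually_at_infinity by auto
  have grow: "norm (F w) \<le> (norm l + 1) * norm w ^ 1" if "max A 1 \<le> norm w" for w
  proof -
    have "norm w > 0" using that by linarith
    then show ?thesis
      using A[of w] that by (simp add: norm_divide field_simps)
  qed
  have F_eq: "F w = F 0 + deriv F 0 * w" for w
  proof -
    have "F w = (\<Sum>k\<le>1. (deriv ^^ k) F 0 / fact k * w ^ k)"
      by (rule Liouville_polynomial[OF F grow])
    also have "\<dots> = F 0 + deriv F 0 * w"
      by (simp add: atMost_Suc)
    finally show ?thesis .
  qed
  have "((\<lambda>w. F 0 / w + deriv F 0) \<longlongrightarrow> 0 + deriv F 0) at_infinity"
    by (intro tendsto_intros tendsto_divide_0[OF tendsto_const]) (rule filterlim_ident)
  moreover have "F 0 / w + deriv F 0 = F w / w" if "1 \<le> norm w" for w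
  proof -
    have "w \<noteq> 0" using that by auto
    then show ?thesis by (subst (2) F_eq) (simp add: add_divide_distrib)
  qed
  then have "eventually (\<lambda>w. F 0 / w + deriv F 0 = F w / w) at_infinity"
    unfolding eventually_at_infinity by blast
  ultimately have "((\<lambda>w. F w / w) \<longlongrightarrow> 0 + deriv F 0) at_infinity"
    by (rule Lim_transform_eventually)
  then have "deriv F 0 = l"
    using tendsto_unique[OF trivial_limit_at_infinity _ lim] by simp
  then show thesis
    using that[of "F 0"] F_eq by (metis add.commute)
qed

context lemniscate_root
begin

lemma q_tendsto: "((\<lambda>w. q w / w) \<longlongrightarrow> of_real c) at_infinity" "filterlim q at_infinity at_infinity"
proof -
  have "0 \<in> V r" by (simp add: V_def)
  then have "isCont H 0"
    using H(1) open_V r by (metis continuous_on_eq_continuous_at holomorphic_on_imp_continuous_on less_imp_le)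
  then have "(H \<longlongrightarrow> of_real c) (at 0)"
    using H(2) by (simp add: isCont_def)
  then have lim: "((\<lambda>w. H (1 / w)) \<longlongrightarrow> of_real c) at_infinity"
    by (simp add: lim_at_infinity_0 o_def inverse_eq_divide)
  moreover have "eventually (\<lambda>w. H (1 / w) = q w / w) at_infinity"
    unfolding eventually_at_infinity by (rule exI[of _ 1]) (auto simp: q_def)
  ultimately show "((\<lambda>w. q w / w) \<longlongrightarrow> of_real c) at_infinity"
    by (rule Lim_transform_eventually)
  have "filterlim (\<lambda>w. H (1 / w) * w) at_infinity at_infinity"
    by (rule tendsto_mult_filterlim_at_infinity[OF lim _ filterlim_ident]) (use H(3) in simp)
  then show "filterlim q at_infinity at_infinity"
    by (simp add: q_def[abs_def] mult.commute)
qed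

lemma q_image_\<Gamma>: "q ` \<Gamma> = sphere 0 1"
proof
  show "q ` \<Gamma> \<subseteq> sphere 0 1"
    using norm_q(1) suplevel_subset_W by (auto simp: \<Gamma>_def)
  show "sphere 0 1 \<subseteq> q ` \<Gamma>"
  proof
    fix z :: complex assume z: "z \<in> sphere 0 1"
    then have "z \<in> q ` {w. norm (poly P w) \<ge> 1}"
      unfolding q_image by simp
    then obtain w where w: "norm (poly P w) \<ge> 1" "z = q w"
      by auto
    then have "w \<in> \<Gamma>"
      using norm_q(1)[OF suplevel_subset_W[OF w(1)]] z by (simp add: \<Gamma>_def)
    then show "z \<in> q ` \<Gamma>" using w by blast
  qed
qed

text \<open>
  Equal fingerprints make the interior maps of both curves and their exterior maps fit together to
  an entire function taking \<open>\<Gamma>\<close> to \<open>\<Gamma>'\<close>.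
\<close>

lemma fingerprint_unique:
  assumes J: "C1_jordan_curve \<Gamma>'" and k: "k \<in> fingerprint \<Gamma>'"
    and kq: "\<And>z. z \<in> sphere 0 1 \<Longrightarrow> k z = q (G z)"
  obtains \<alpha> :: real and \<beta> where "\<alpha> > 0" "\<Gamma>' = (\<lambda>z. of_real \<alpha> * z + \<beta>) ` \<Gamma>"
proof -
  obtain k1 \<phi> f f' g g' where f: "interior_map \<Gamma>' f f'" and g: "exterior_map \<Gamma>' g g'"
    and k1: "\<And>z. z \<in> sphere 0 1 \<Longrightarrow> k1 z = g' (f z)" and \<phi>: "disc_automorphism \<phi>"
    and kk1: "\<And>z. z \<in> sphere 0 1 \<Longrightarrow> k z = k1 (\<phi> z)"
    using k unfolding fingerprint_def welding_map_def moebius_related_def by blast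
  note \<phi>s = disc_automorphism_facts[OF \<phi>]
  have f_hol: "f holomorphic_on ball 0 1" and f_bij: "bij_betw f (ball 0 1) (inside \<Gamma>')"
    and f_hom: "homeomorphism (cball 0 1) (closure (inside \<Gamma>')) f f'"
    using f unfolding interior_map_def by auto
  obtain a cc R where g_hol: "g holomorphic_on {z. norm z > 1}"
    and g_bij: "bij_betw g {z. norm z > 1} (- closure (inside \<Gamma>'))"
    and g_hom: "homeomorphism {z. norm z \<ge> 1} (closure (- closure (inside \<Gamma>'))) g g'"
    and a: "a > (0::real)" and g_exp: "\<And>z. norm z > R \<Longrightarrow> (\<lambda>m. cc m / z ^ m) sums (g z - complex_of_real a * z)"
    using g unfolding exterior_map_def by blast
  note J' = jordan_curve_facts[OF J]
  have f_sphere: "f ` sphere 0 1 = \<Gamma>'"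
  proof -
    have "f ` (cball 0 1 - ball 0 1) = closure (inside \<Gamma>') - inside \<Gamma>'"
      by (rule homeomorphism_boundary_image[OF f_hom f_bij]) (auto simp: closure_subset)
    also have "\<dots> = \<Gamma>'"
      unfolding J'(1) using J'(2) by blast
    finally show ?thesis
      by (simp add: cball_diff_eq_sphere)
  qed
  have g_sphere: "g ` sphere 0 1 = \<Gamma>'"
  proof -
    have "g ` ({z. norm z \<ge> 1} - {z. norm z > 1}) = closure (- closure (inside \<Gamma>')) - (- closure (inside \<Gamma>'))"
      by (rule homeomorphism_boundary_image[OF g_hom g_bij]) (auto intro: closure_subset[THEN subsetD])
    also have "\<dots> = \<Gamma>'"
      unfolding J'(3) using J'(4) by blast
    also have "{z::complex. norm z \<ge> 1} - {z. norm z > 1} = sphere 0 1" by auto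
    finally show ?thesis .
  qed
  \<comment> \<open>The welding relations give \<open>g' (f (\<phi> z)) = k z = q (G z)\<close>;
    applying \<open>g\<close> yields agreement of the interior and exterior formulas on the
    curve.\<close>
  have match: "f (\<phi> z) = g (q (G z))" if z: "norm z = 1" for z
  proof -
    have "\<phi> z \<in> sphere 0 1" using \<phi>s(4)[OF z] by simp
    then have "f (\<phi> z) \<in> closure (- closure (inside \<Gamma>'))"
      unfolding J'(3) using f_sphere by blast
    then have "g (g' (f (\<phi> z))) = f (\<phi> z)"
      by (rule homeomorphism_apply2[OF g_hom])
    then show ?thesis
      using kq[of z] kk1[of z] k1[OF \<open>\<phi> z \<in> sphere 0 1\<close>] z by simp
  qed
  obtain G' where G': "G' holomorphic_on (G ` U)" "\<And>z. z \<in> U \<Longrightarrow> G' (G z) = z"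
    using holomorphic_has_inverse[OF G(1) U(1) G(2)] by metis
  \<comment> \<open>Inside the curve this is the interior map of \<open>\<Gamma>'\<close> after the
    inverse of that of \<open>\<Gamma>\<close>, corrected by \<open>\<phi>\<close>; outside it is
    the same for the exterior maps, \<open>q\<close> being the inverse of the one for
    \<open>\<Gamma>\<close>.\<close>
  define F where "F w = (if norm (poly P w) \<le> 1 then f (\<phi> (G' w)) else g (q w))" for w
  have FG: "F (G z) = f (\<phi> z)" if "norm z \<le> 1" for z
  proof -
    have "z \<in> U" using that U(2) by auto
    moreover have "norm (poly P (G z)) \<le> 1"
      using that PG_less[of z] PG_eq[of z] by (cases "norm z = 1") auto
    ultimately show ?thesis by (simp add: F_def G'(2))
  qed
  have Fq: "F w = g (q w)" if w: "norm (poly P w) \<ge> 1" for w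
  proof (cases "norm (poly P w) = 1")
    case True
    then have "w \<in> G ` sphere 0 1"
      unfolding \<Gamma>_eq[symmetric] by (simp add: \<Gamma>_def)
    then obtain z where z: "w = G z" "norm z = 1"
      by auto
    then show ?thesis using FG[of z] match[OF z(2)] by simp
  qed (use w in \<open>simp add: F_def\<close>)
  have contf: "continuous_on (cball 0 1) f" and contg: "continuous_on {z. norm z \<ge> 1} g"
    using homeomorphism_cont1 f_hom g_hom by blast+
  have \<phi>_in: "\<phi> z \<in> cball 0 1" if "z \<in> cball 0 1" for z
    using \<phi>s(3,4)[of z] that by (cases "norm z = 1") auto
  have contF: "continuous_on UNIV F"
  proof -
    have G'_in: "G' w \<in> cball 0 1" if "norm (poly P w) \<le> 1" for w
    proof -
      have "w \<in> G ` cball 0 1"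
        unfolding sublevel_closed_eq[symmetric] using that by simp
      then obtain z where z: "w = G z" "z \<in> cball 0 1"
        by blast
      then have "z \<in> U" using U(2) by blast
      then show ?thesis using G'(2) z by simp
    qed
    have sub: "{w. norm (poly P w) \<le> 1} \<subseteq> G ` U"
      unfolding sublevel_closed_eq using U(2) by blast
    have c1: "continuous_on {w. norm (poly P w) \<le> 1} G'"
      using holomorphic_on_imp_continuous_on[OF G'(1)] sub by (rule continuous_on_subset)
    have c2: "continuous_on {w. norm (poly P w) \<le> 1} (\<lambda>w. \<phi> (G' w))"
      by (rule continuous_on_compose2[OF \<phi>s(1) c1]) (use G'_in in blast)
    have "continuous_on ({w. norm (poly P w) \<le> 1} \<union> {w. norm (poly P w) \<ge> 1}) F"
      unfolding F_def[abs_def]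
    proof (rule continuous_on_cases)
      show "closed {w. norm (poly P w) \<le> 1}" "closed {w. norm (poly P w) \<ge> 1}"
        by (intro closed_Collect_le poly_continuous continuous_on_const)+
      show "continuous_on {w. norm (poly P w) \<le> 1} (\<lambda>w. f (\<phi> (G' w)))"
        by (rule continuous_on_compose2[OF contf c2]) (use G'_in \<phi>_in in blast)
      show "continuous_on {w. norm (poly P w) \<ge> 1} (\<lambda>w. g (q w))"
        by (rule continuous_on_compose2[OF contg q_continuous]) (use q_image in blast)
      show "\<forall>w. w \<in> {w. norm (poly P w) \<le> 1} \<and> \<not> norm (poly P w) \<le> 1 \<or>
          w \<in> {w. norm (poly P w) \<ge> 1} \<and> norm (poly P w) \<le> 1 \<longrightarrow> f (\<phi> (G' w)) = g (q w)"
        using Fq F_def by (metis (mono_tags, lifting) mem_Collect_eq)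
    qed
    moreover have "{w. norm (poly P w) \<le> 1} \<union> {w. norm (poly P w) \<ge> 1} = UNIV" by auto
    ultimately show ?thesis by simp
  qed
  have F_ext: "F holomorphic_on {w. norm (poly P w) > 1}"
  proof -
    have "(\<lambda>w. g (q w)) holomorphic_on {w. norm (poly P w) > 1}"
      by (rule holomorphic_on_compose_gen[OF _ g_hol, unfolded o_def])
        (use q_image_exterior suplevel_subset_W in \<open>auto intro!: holomorphic_on_subset[OF q_holomorphic]\<close>)
    then show ?thesis
      by (rule holomorphic_transform) (simp add: Fq)
  qed
  \<comment> \<open>Pulling back by \<open>G\<close> turns the curve into the unit circle, where
    \<open>holomorphic_across_circle\<close> applies; \<open>G'\<close> carries the result back to a
    neighbourhood of the curve.\<close>
  have FG_hol: "(\<lambda>z. F (G z)) holomorphic_on U"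
  proof (rule holomorphic_across_circle[OF U(1)])
    show "continuous_on U (\<lambda>z. F (G z))"
      by (rule continuous_on_compose2[OF contF continuous_G]) simp
    have "(\<lambda>z. f (\<phi> z)) holomorphic_on ball 0 1"
      by (rule holomorphic_on_compose_gen[OF \<phi>s(2) f_hol, unfolded o_def]) (use \<phi>s(3) in auto)
    then have 1: "(\<lambda>z. F (G z)) holomorphic_on ball 0 1"
      by (rule holomorphic_transform) (simp add: FG)
    have "norm (poly P (G z)) > 1" if "z \<in> U" "norm z > 1" for z
    proof -
      have "G z \<notin> G ` cball 0 1" using G_in_K_iff[OF that(1), of 1] that(2) by simp
      then show ?thesis using suplevel_eq by blast
    qed
    then have 2: "(\<lambda>z. F (G z)) holomorphic_on (U - cball 0 1)"
      by (intro holomorphic_on_compose_gen[OF holomorphic_on_subset[OF G(1)] F_ext, unfolded o_def]) auto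
    have "(\<lambda>z. F (G z)) holomorphic_on (ball 0 1 \<union> (U - cball 0 1))"
      using 1 2 U(1) by (intro holomorphic_on_Un) auto
    then show "(\<lambda>z. F (G z)) holomorphic_on U - sphere 0 1"
      by (rule holomorphic_on_subset) auto
  qed
  have "(\<lambda>w. F (G (G' w))) holomorphic_on G ` U"
    by (rule holomorphic_on_compose_gen[OF G'(1) FG_hol, unfolded o_def]) (use G'(2) in auto)
  then have "F holomorphic_on G ` U"
    by (rule holomorphic_transform) (use G'(2) in auto)
  moreover have "open (G ` U)"
    by (rule open_mapping_thm3[OF G(1) U(1) G(2)])
  ultimately have "F holomorphic_on (G ` U \<union> {w. norm (poly P w) > 1})"
    using F_ext open_suplevel by (intro holomorphic_on_Un)
  moreover have "G ` U \<union> {w. norm (poly P w) > 1} = UNIV"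
    unfolding suplevel_eq using U(2) by auto
  ultimately have entire: "F holomorphic_on UNIV" by simp
  \<comment> \<open>The slope of \<open>F\<close> at infinity is the product of \<open>a\<close>
    from \<open>g\<close> and \<open>c\<close> from \<open>q\<close>, both positive.\<close>
  have "((\<lambda>w. g (q w) / q w * (q w / w)) \<longlongrightarrow> of_real a * of_real c) at_infinity"
    using filterlim_compose[OF exterior_expansion_tendsto[OF g_exp] q_tendsto(2)] q_tendsto(1)
    by (rule tendsto_mult)
  moreover have "eventually (\<lambda>w. g (q w) / q w * (q w / w) = F w / w) at_infinity"
  proof -
    obtain M where M: "M > 0" "\<And>w. w \<in> {w. norm (poly P w) \<le> 1} \<Longrightarrow> norm w \<le> M"
      using bounded_sublevel[of 1] unfolding bounded_pos by blast
    have "g (q w) / q w * (q w / w) = F w / w" if "M + 1 \<le> norm w" for w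
    proof -
      have w: "norm (poly P w) > 1"
        using M(2)[of w] that by force
      then have "norm (q w) > 1"
        using norm_q(2) suplevel_subset_W by simp
      then have "q w \<noteq> 0" by auto
      then show ?thesis using Fq[of w] w by simp
    qed
    then show ?thesis unfolding eventually_at_infinity by blast
  qed
  ultimately have "((\<lambda>w. F w / w) \<longlongrightarrow> of_real a * of_real c) at_infinity"
    by (rule Lim_transform_eventually)
  then have "((\<lambda>w. F w / w) \<longlongrightarrow> of_real (a * c)) at_infinity"
    by simp
  then obtain b where b: "\<And>w. F w = of_real (a * c) * w + b"
    using linear_growth_imp_affine[OF entire] by blast
  have "\<Gamma>' = g ` q ` \<Gamma>"
    using g_sphere q_image_\<Gamma> by simp
  also have "\<dots> = F ` \<Gamma>"
    unfolding image_image by (rule image_cong) (simp_all add: Fq \<Gamma>_def)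
  also have "\<dots> = (\<lambda>z. of_real (a * c) * z + b) ` \<Gamma>"
    by (rule image_cong) (simp_all only: b)
  finally show thesis
    using that[of "a * c" b] a H(3) by simp
qed

end

section \<open>Existence\<close>

text \<open>A rotation of the plane makes the root \<open>q\<close> of \<open>P\<close> positive at infinity.\<close>

lemma (in lemniscate) normalised_root:
  assumes H: "H holomorphic_on V r" "H 0 \<noteq> 0"
    "\<And>v. v \<in> V r \<Longrightarrow> v \<noteq> 0 \<Longrightarrow> H v ^ n = v ^ n * poly P (1 / v)"
  obtains \<tau> Q K c where "lemniscate_root n Q U (\<lambda>z. \<tau> * G z) r K c"
    "\<And>z. lemniscate_root.q K (\<tau> * G z) = G z * H (1 / G z)"
proof -
  define \<tau> where "\<tau> = H 0 / of_real (norm (H 0))"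
  have \<tau>: "norm \<tau> = 1" "\<tau> \<noteq> 0" "H 0 = \<tau> * of_real (norm (H 0))"
    using H(2) by (simp_all add: \<tau>_def norm_divide)
  define Q where "Q = pcompose P [:0, 1 / \<tau>:]"
  have Q: "poly Q w = poly P (w / \<tau>)" for w
    by (simp add: Q_def poly_pcompose)
  have L: "lemniscate n Q U (\<lambda>z. \<tau> * G z) r"
  proof
    show "degree Q = n" using deg \<tau>(2) by (simp add: Q_def degree_pcompose)
    show "(\<lambda>z. \<tau> * G z) holomorphic_on U" using G(1) by (intro holomorphic_intros)
    show "inj_on (\<lambda>z. \<tau> * G z) U" using G(2) \<tau>(2) by (auto simp: inj_on_def)
    show "w \<in> (\<lambda>z. \<tau> * G z) ` cball 0 r" if w: "poly Q w = 0" for w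
    proof -
      have "w / \<tau> \<in> G ` cball 0 r"
        using zeros w by (simp add: Q)
      then obtain z where "w / \<tau> = G z" "z \<in> cball 0 r"
        by blast
      then show ?thesis
        using \<tau>(2) by (intro image_eqI[of _ _ z]) (auto simp: field_simps)
    qed
  qed (use n U G(3) r PG_less PG_eq \<tau>(2) in \<open>auto simp: Q\<close>)
  define V' where "V' = lemniscate.V (\<lambda>z. \<tau> * G z)"
  have V': "v \<in> V' t \<longleftrightarrow> \<tau> * v \<in> V t" for v t
  proof (cases "v = 0")
    case False
    have "1 / v \<in> (\<lambda>z. \<tau> * G z) ` cball 0 t \<longleftrightarrow> 1 / (\<tau> * v) \<in> G ` cball 0 t"
      using \<tau>(2) False by (auto simp: image_iff field_simps)
    then show ?thesis
      using False \<tau>(2) unfolding V'_def V_def lemniscate.V_def[OF L] by simp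
  qed (simp add: V'_def V_def lemniscate.V_def[OF L])
  \<comment> \<open>A point \<open>v\<close> lies in \<open>V' t\<close> when
    \<open>\<tau> * v\<close> lies in \<open>V t\<close>, which explains the argument of
    \<open>H\<close>. The quotient by \<open>\<tau>\<close> makes \<open>K 0\<close> positive and
    cancels the rotation in \<open>w\<close>, so \<open>q\<close> keeps its values at corresponding
    points.\<close>
  define K where "K v = H (\<tau> * v) / \<tau>" for v
  have R: "lemniscate_root n Q U (\<lambda>z. \<tau> * G z) r K (norm (H 0))"
    unfolding lemniscate_root_def lemniscate_root_axioms_def V'_def[symmetric]
  proof (intro conjI allI impI L)
    have "(\<lambda>v. H (\<tau> * v)) holomorphic_on V' r"
      by (rule holomorphic_on_compose_gen[OF _ H(1), unfolded o_def])
        (auto intro!: holomorphic_intros simp: V')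
    then show "K holomorphic_on V' r"
      unfolding K_def[abs_def] using \<tau>(2) by (intro holomorphic_intros)
    show "K 0 = of_real (norm (H 0))"
      unfolding K_def using \<tau>(2,3) by (metis mult_zero_right nonzero_mult_div_cancel_left)
    show "norm (H 0) > 0" using H(2) by simp
    show "K v ^ n = v ^ n * poly Q (1 / v)" if "v \<in> V' r" "v \<noteq> 0" for v
      using H(3)[of "\<tau> * v"] that \<tau>(2)
      by (simp add: V' K_def Q power_divide power_mult_distrib mult.commute)
  qed
  show thesis
  proof (rule that[OF R])
    show "lemniscate_root.q K (\<tau> * G z) = G z * H (1 / G z)" for z
      unfolding lemniscate_root.q_def[OF R] K_def using \<tau>(2) by simp
  qed
qed

theorem theorem3p1:
  fixes n :: nat and \<theta> :: real and a :: "nat \<Rightarrow> complex" and k :: "complex \<Rightarrow> complex"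
  assumes "n \<ge> 1"
    and "\<forall>j\<in>{1..n}. norm (a j) < 1"
    and "continuous_on (sphere 0 1) k"
    and "k ` sphere 0 1 \<subseteq> sphere 0 1"
    and "\<forall>z\<in>sphere 0 1. k z ^ n = blaschke_product \<theta> a n z"
  shows "\<exists>\<Gamma>. proper_lemniscate n \<Gamma> \<and> C1_jordan_curve \<Gamma> \<and> k \<in> fingerprint \<Gamma> \<and>
           (\<forall>\<Gamma>'. C1_jordan_curve \<Gamma>' \<and> fingerprint \<Gamma>' = fingerprint \<Gamma> \<longrightarrow>
              (\<exists>(\<alpha>::real) (\<beta>::complex). \<alpha> > 0 \<and>
                 \<Gamma>' = (\<lambda>z. complex_of_real \<alpha> * z + \<beta>) ` \<Gamma>))"
proof -
  \<comment> \<open>Inserting \<open>1 / 2\<close> ensures \<open>r > 0\<close>, also when all zeros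
    lie at the origin.\<close>
  define r where "r = Max (insert (1 / 2) ((\<lambda>j. norm (a j)) ` {1..n}))"
  have fin: "finite (insert (1 / 2) ((\<lambda>j. norm (a j)) ` {1..n}))" by simp
  have r: "0 < r" "r < 1" and ar: "\<And>j. j \<in> {1..n} \<Longrightarrow> norm (a j) \<le> r"
  proof -
    have "1 / 2 \<le> r" unfolding r_def using fin by (intro Max_ge) auto
    then show "0 < r" by simp
    show "r < 1" unfolding r_def using assms(2) fin by (subst Max_less_iff) auto
    show "norm (a j) \<le> r" if "j \<in> {1..n}" for j
      unfolding r_def using fin that by (intro Max_ge) auto
  qed
  \<comment> \<open>The midpoint between 1 and \<open>1 / r\<close>, so that \<open>1 < s\<close>
    and \<open>r * s < 1\<close>.\<close>
  define s where "s = (1 + 1 / r) / 2"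
  interpret blaschke n r s "((s + r) / (1 + r * s)) ^ n"
    by unfold_locales (use assms(1) r in \<open>auto simp: s_def field_simps\<close>)
  define B where "B = blaschke_product \<theta> a n"
  define U where "U = collar s B (((s + r) / (1 + r * s)) ^ n)"
  obtain P G where P: "degree P = n" "G holomorphic_on U" "inj_on G U" "G 0 = 0"
    "\<And>z. z \<in> U \<Longrightarrow> poly P (G z) = B z" "\<And>w. poly P w = 0 \<Longrightarrow> w \<in> G ` cball 0 r"
    using polynomial_model[OF ar B_def] unfolding U_def by metis
  have cU: "cball 0 1 \<subseteq> U"
    unfolding U_def by (rule cball_subset_collar[OF ar B_def])
  have in_U: "z \<in> U" if "norm z \<le> 1" for z
    using cU that by auto
  interpret L: lemniscate n P U G r
  proof
    show "open U" unfolding U_def by (rule open_collar[OF ar B_def])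
    show "norm (poly P (G z)) < 1" if "norm z < 1" for z
      using P(5)[OF in_U] norm_blaschke_less_1[OF ar B_def that] that by simp
    show "norm (poly P (G z)) = 1" if "norm z = 1" for z
      using P(5)[OF in_U] norm_blaschke_eq_1[OF ar B_def that] that by simp
  qed (use assms(1) P cU r in auto)
  obtain H where H: "H holomorphic_on L.V r" "H 0 \<noteq> 0"
    "\<And>v. v \<in> L.V r \<Longrightarrow> v \<noteq> 0 \<Longrightarrow> H v ^ n = v ^ n * poly P (1 / v)"
    using L.root_exists by metis
  \<comment> \<open>The root of \<open>P\<close> on the curve before normalisation, pulled back to
    the circle by \<open>G\<close>; like \<open>k\<close>, it is a continuous \<open>n\<close>-th
    root of \<open>B\<close> there.\<close>
  define q where "q z = G z * H (1 / G z)" for z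
  have GV: "1 / G z \<in> L.V r" "G z \<noteq> 0" if z: "norm z = 1" for z
  proof -
    have "G z \<notin> G ` cball 0 r"
      using L.G_in_K_iff[OF in_U, of z r] r z by simp
    then show "1 / G z \<in> L.V r" by (simp add: L.V_def)
    have "z \<noteq> 0" using z by auto
    then show "G z \<noteq> 0" using L.G_nonzero[of z 1] z by simp
  qed
  have q_pow: "q z ^ n = k z ^ n" if z: "norm z = 1" for z
  proof -
    have "q z ^ n = poly P (G z)"
      using H(3)[OF GV(1)[OF z]] GV(2)[OF z] by (simp add: q_def power_mult_distrib field_simps)
    also have "\<dots> = k z ^ n"
      using P(5)[OF in_U] assms(5) z by (simp add: B_def)
    finally show ?thesis .
  qed
  have k1: "norm (k z) = 1" if "norm z = 1" for z
    using assms(4) that by (auto simp: subset_eq)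
  have q_nz: "q z \<noteq> 0" if "norm z = 1" for z
    using q_pow[OF that] k1[OF that] assms(1) by (auto simp: power_0_left)
  have q_cont: "continuous_on (sphere 0 1) q"
  proof -
    have G: "continuous_on (sphere 0 1) G"
      using cU by (intro continuous_on_subset[OF L.continuous_G]) auto
    have "continuous_on (sphere 0 1) (\<lambda>z. H (1 / G z))"
      by (rule continuous_on_compose2[OF holomorphic_on_imp_continuous_on[OF H(1)]])
        (use G GV in \<open>auto intro!: continuous_intros\<close>)
    then show ?thesis
      unfolding q_def[abs_def] using G by (intro continuous_intros)
  qed
  \<comment> \<open>The quotient is continuous on the connected circle and takes values among the
    finitely many \<open>n\<close>-th roots of unity.\<close>
  have "(\<lambda>z. k z / q z) constant_on sphere 0 1"
  proof (rule continuous_finite_range_constant)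
    show "connected (sphere (0::complex) 1)"
      by (rule connected_sphere) simp
    show "continuous_on (sphere 0 1) (\<lambda>z. k z / q z)"
      using q_nz by (intro continuous_intros q_cont assms(3)) auto
    have "(k z / q z) ^ n = 1" if "norm z = 1" for z
      using q_pow[OF that] q_nz[OF that] by (simp add: power_divide flip: q_pow[OF that])
    then have "(\<lambda>z. k z / q z) ` sphere 0 1 \<subseteq> {w. w ^ n = 1}"
      by auto
    moreover have "finite {w::complex. w ^ n = 1}"
      using assms(1) by (intro finite_roots_unity) auto
    ultimately show "finite ((\<lambda>z. k z / q z) ` sphere 0 1)"
      by (rule finite_subset)
  qed
  then obtain \<omega> where "\<And>z. z \<in> sphere 0 1 \<Longrightarrow> k z / q z = \<omega>"
    unfolding constant_on_def by metis
  then have kq: "k z = \<omega> * q z" if "norm z = 1" for z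
    using q_nz[OF that] that by (force simp: field_simps)
  have \<omega>: "\<omega> ^ n = 1" "\<omega> \<noteq> 0"
  proof -
    have "(\<omega> * q 1) ^ n = q 1 ^ n"
      using kq[of 1] q_pow[of 1] by simp
    then show "\<omega> ^ n = 1" using q_nz[of 1] by (simp add: power_mult_distrib)
    then show "\<omega> \<noteq> 0" using assms(1) by (auto simp: power_0_left)
  qed
  \<comment> \<open>The constant \<open>\<omega>\<close> goes into the root first, as
    \<open>\<omega> * H\<close> satisfies the same equation; the rotation by \<open>\<tau>\<close>
    then makes the root positive at infinity without changing its values on the curve.\<close>
  obtain \<tau> Q K c where R: "lemniscate_root n Q U (\<lambda>z. \<tau> * G z) r K c"
    and qK: "\<And>z. lemniscate_root.q K (\<tau> * G z) = G z * (\<omega> * H (1 / G z))"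
  proof (rule L.normalised_root[of "\<lambda>v. \<omega> * H v"])
    show "(\<lambda>v. \<omega> * H v) holomorphic_on L.V r"
      using H(1) by (intro holomorphic_intros)
    show "(\<omega> * H v) ^ n = v ^ n * poly P (1 / v)" if "v \<in> L.V r" "v \<noteq> 0" for v
      using H(3)[OF that] \<omega>(1) by (simp add: power_mult_distrib)
  qed (use H(2) \<omega>(2) in auto)
  interpret R: lemniscate_root n Q U "\<lambda>z. \<tau> * G z" r K c
    by (rule R)
  have k_eq: "k z = R.q (\<tau> * G z)" if "z \<in> sphere 0 1" for z
    using qK[of z] kq[of z] that by (simp add: q_def)
  show ?thesis
  proof (intro exI[of _ R.\<Gamma>] conjI allI impI)
    show "proper_lemniscate n R.\<Gamma>" by (rule R.proper_lemniscate_\<Gamma>)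
    show "C1_jordan_curve R.\<Gamma>" by (rule R.C1_jordan_curve_\<Gamma>)
    show k: "k \<in> fingerprint R.\<Gamma>" using k_eq by (rule R.fingerprint_\<Gamma>)
    fix \<Gamma>' assume "C1_jordan_curve \<Gamma>' \<and> fingerprint \<Gamma>' = fingerprint R.\<Gamma>"
    then have "C1_jordan_curve \<Gamma>'" "k \<in> fingerprint \<Gamma>'" using k by auto
    then obtain \<alpha> :: real and \<beta> where "\<alpha> > 0" "\<Gamma>' = (\<lambda>z. of_real \<alpha> * z + \<beta>) ` R.\<Gamma>"
      using R.fingerprint_unique[of \<Gamma>' k] k_eq by blast
    then show "\<exists>(\<alpha>::real) (\<beta>::complex). \<alpha> > 0 \<and> \<Gamma>' = (\<lambda>z. complex_of_real \<alpha> * z + \<beta>) ` R.\<Gamma>"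
      by blast
  qed
qed

end
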